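(* Let $n\ge6$, let $e=0$ if $n$ is even and $e=1$ if $n$ is odd, and let $D$ be a crossing optimal 2-page book drawing of $K_n$. Then there exists a drawing $D'$ equivalent to $D$ such that $M(D')$ satisfies: (1) for $4+e\le s\le\lfloor n/2\rfloor+1$ and for $n+2+e\le s\le n+\lfloor n/2\rfloor+1$, the entry $(r,s-r)$ is blue for all integers $r$ with $\max\{1,s-n\}\le r\le (s-5)/2$; (2) for $\lceil n/2\rceil+2+e\le s\le n$ and for $n+\lceil n/2\rceil+2+e\le s\le 2n-2-e$, the entry $(r,s-r)$ is red for all integers $r$ with $\max\{1,s-n\}\le r\le(s-5)/2$, except for the entry $(1,n)$, which is blue; (3) if $n$ is odd, the entries $(1,\lceil n/2\rceil+1)$ and $(\lfloor n/2\rfloor,\lceil n/2\rceil+1)$ are red, and the entries $(2,n)$ and $(\lceil n/2\rceil,\lceil n/2\rceil+2)$ are blue.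
   Context: Normalized 2-page book drawings of $K_n$: the vertices are $(1,0),\dots,(n,0)$, labelled $1,\dots,n$ left to right; each edge $i(i+1)$ ($1\le i\le n-1$) is drawn on the $x$-axis (spine); the edge $1n$ is drawn in the upper half-plane; every other edge $ij$ is a semicircle over $[i,j]$ in either the upper or lower half-plane. Edges drawn on the spine or in the upper half-plane are blue, those in the lower half-plane red. The 2-page matrix $M(D)$ has entries $(i,j)$, $1\le i<j\le n$ (row $i$, column $j$), the entry $(i,j)$ having the color of edge $ij$. $D$ is crossing optimal if its number of crossings equals $Z(n)=\frac14\lfloor\frac n2\rfloor\lfloor\frac{n-1}2\rfloor\lfloor\frac{n-2}2\rfloor\lfloor\frac{n-3}2\rfloor$. Transformations of such drawings (specified by colors): $f(D)$ gives edge $(j-1)n$ the color of $1j$ in $D$ for $2\le j\le n$, and edge $(i-1)(j-1)$ the color of $ij$ in $D$ for $1<i<j\le n$; $g(D)$ gives edge $ij$ the color of edge $(n+1-j)(n+1-i)$ in $D$; $h(D)$ switches the color of every edge except the spine edges $i(i+1)$ and the edge $1n$. Two drawings are equivalent if one is obtained from the other by a finite composition of $f,g,h$. *)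

theory Defs
  imports Complex_Main
begin

datatype color = Blue | Red

fun flip :: "color \<Rightarrow> color" where
  "flip Blue = Red" | "flip Red = Blue"

text \<open>A 2-page book drawing of K_n is recorded by the colours of its edges:
  D (i,j) is the colour of edge ij for 1 <= i < j <= n (Blue = spine or upper page,
  Red = lower page). Outside this index range the value is fixed to Red (canonical).\<close>
type_synonym drawing = "nat \<times> nat \<Rightarrow> color"

definition edges :: "nat \<Rightarrow> (nat \<times> nat) set" where
  "edges n = {(i,j). 1 \<le> i \<and> i < j \<and> j \<le> n}"

definition normalized_drawing :: "nat \<Rightarrow> drawing \<Rightarrow> bool" where
  "normalized_drawing n D \<longleftrightarrow>
     (\<forall>e. e \<notin> edges n \<longrightarrow> D e = Red) \<and>
     (\<forall>i. 1 \<le> i \<and> i < n \<longrightarrow> D (i, i+1) = Blue) \<and>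
     D (1, n) = Blue"

text \<open>Two edges ij, kl (i<j, k<l) drawn as semicircles on the same page cross iff
  their endpoints interleave. Spine edges and the edge 1n never interleave with anything.\<close>
definition crossings :: "nat \<Rightarrow> drawing \<Rightarrow> nat" where
  "crossings n D = card {((i,j),(k,l)). (i,j) \<in> edges n \<and> (k,l) \<in> edges n \<and>
       i < k \<and> k < j \<and> j < l \<and> D (i,j) = D (k,l)}"

definition Z :: "nat \<Rightarrow> real" where
  "Z n = (1/4) * real (n div 2) * real ((n-1) div 2) * real ((n-2) div 2) * real ((n-3) div 2)"

definition crossing_optimal :: "nat \<Rightarrow> drawing \<Rightarrow> bool" where
  "crossing_optimal n D \<longleftrightarrow> normalized_drawing n D \<and> real (crossings n D) = Z n"

definition f_tr :: "nat \<Rightarrow> drawing \<Rightarrow> drawing" where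
  "f_tr n D = (\<lambda>(a,b). if (a,b) \<notin> edges n then Red
                        else if b = n then D (1, a+1) else D (a+1, b+1))"

definition g_tr :: "nat \<Rightarrow> drawing \<Rightarrow> drawing" where
  "g_tr n D = (\<lambda>(a,b). if (a,b) \<notin> edges n then Red else D (n+1-b, n+1-a))"

definition h_tr :: "nat \<Rightarrow> drawing \<Rightarrow> drawing" where
  "h_tr n D = (\<lambda>(a,b). if (a,b) \<notin> edges n then Red
                        else if b = a+1 \<or> (a,b) = (1,n) then D (a,b) else flip (D (a,b)))"

definition tr_step :: "nat \<Rightarrow> drawing \<Rightarrow> drawing \<Rightarrow> bool" where
  "tr_step n X Y \<longleftrightarrow> Y = f_tr n X \<or> Y = g_tr n X \<or> Y = h_tr n X"

definition equivalent :: "nat \<Rightarrow> drawing \<Rightarrow> drawing \<Rightarrow> bool" where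
  "equivalent n D D' \<longleftrightarrow> (tr_step n)\<^sup>*\<^sup>* D D' \<or> (tr_step n)\<^sup>*\<^sup>* D' D"

end

theory Submission
  imports Defs
begin

text \<open>
  The number of crossings is an affine function, with positive coefficients, of the numbers of
  \<open>\<le>\<le>k\<close>-edges, which are bounded below by induction on \<open>n\<close>, removing the last vertex. In a crossing
  optimal drawing all these bounds are tight, also those used in the induction step, row by row of
  the 2-page matrix. Since rotations and the reflection preserve optimality, the resulting local
  condition holds with every vertex in the role of the last one and in both directions.

  From there on only this local condition is used. It forces two consecutive longest chords at some
  vertex to have different colours, since otherwise a longest chord of the minority colour would
  give an even longer one. Such a change at vertex \<open>0\<close> determines the colours at \<open>0\<close>, then those of
  the chords between the two halves of the circle cut at \<open>0\<close>, and finally those inside each half.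
\<close>

section \<open>Edges and their sides\<close>

text \<open>Any four vertices contribute exactly three to the number of crossings plus the number of
  pairs separated by an edge, so few crossings mean that edges split the other vertices evenly.
  Summation over \<open>q\<close> turns the products of the two sides into the truncated differences
  of \<open>weight\<close>.

  The bound works row by row because in row \<open>i\<close> the values of \<open>along\<close> are
  0, 1, ..., each taken once, whatever the colours are, while \<open>above\<close> is at most
  \<open>i - 1\<close>. Tightness for all \<open>q\<close> below \<open>m\<close> leaves each entry
  two options: \<open>above\<close> is all of \<open>i - 1\<close>, or the side of the edge away
  from the last vertex has at least \<open>m - 1\<close> vertices. With an arbitrary vertex
  \<open>v\<close> as the last one this is \<open>balance_up\<close>. It is applied where arithmetic
  excludes the second option or makes it as strong as the first; one change of colour then spreads
  over an arc of vertices.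

  For odd \<open>n\<close> the two longest chords at a vertex have the same cyclic length, so a
  reflection combined with an exchange of the colours preserves a change. This spare symmetry pays
  for the assumption \<open>tip\<close>, which decides the entry \<open>n - 2\<close> of row 0 that
  counting alone does not reach.\<close>

text \<open>Positions satisfying \<open>P\<close> are ranked from the right, the others after them from the left.\<close>
definition rank :: "nat \<Rightarrow> (nat \<Rightarrow> bool) \<Rightarrow> nat \<Rightarrow> nat" where
  "rank N P a = (if P a then 0 else a) + card {k\<in>{a<..<N}. P k}"

lemma rank_Suc: "a < N \<Longrightarrow> rank (Suc N) P a = rank N P a + (if P N then 1 else 0)"
proof -
  assume "a < N"
  then have "{k\<in>{a<..<Suc N}. P k} = (if P N then insert N {k\<in>{a<..<N}. P k} else {k\<in>{a<..<N}. P k})"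
    by (auto simp: less_Suc_eq)
  then show ?thesis by (simp add: rank_def)
qed

text \<open>Appending position \<open>N\<close> either raises all earlier ranks by one and gives
  rank 0 to \<open>N\<close>, or leaves them alone and gives rank \<open>N\<close> to
  \<open>N\<close>.\<close>

lemma bij_betw_rank: "bij_betw (rank N P) {..<N} {..<N}"
proof -
  have "rank N P ` {..<N} = {..<N}"
  proof (induction N)
    case (Suc N)
    have top: "rank (Suc N) P N = (if P N then 0 else N)"
      by (simp add: rank_def)
    have "rank (Suc N) P ` {..<N} = (\<lambda>l. l + (if P N then 1 else 0)) ` rank N P ` {..<N}"
      unfolding image_image by (rule image_cong) (auto simp: rank_Suc)
    also have "\<dots> = (\<lambda>l. l + (if P N then 1 else 0)) ` {..<N}"
      by (simp add: Suc.IH)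
    finally have "rank (Suc N) P ` {..<Suc N}
        = insert (if P N then 0 else N) ((\<lambda>l. l + (if P N then 1 else 0)) ` {..<N})"
      by (simp add: lessThan_Suc top)
    also have "\<dots> = {..<Suc N}"
    proof (cases "P N")
      case True
      then show ?thesis by (simp add: lessThan_Suc_eq_insert_0)
    next
      case False
      then show ?thesis by (simp add: lessThan_Suc)
    qed
    finally show ?case .
  qed simp
  then show ?thesis by (simp add: bij_betw_def eq_card_imp_inj_on)
qed

lemma card_rank_less:
  assumes "s \<le> N"
  shows "card {a\<in>{..<N}. rank N P a < s} = s"
proof -
  have "bij_betw (rank N P) {a\<in>{..<N}. rank N P a < s} {..<s}"
    unfolding bij_betw_def
  proof
    show "inj_on (rank N P) {a\<in>{..<N}. rank N P a < s}"
      using bij_betw_rank[of N P] by (auto simp: bij_betw_def intro: inj_on_subset)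
    have "rank N P ` {a\<in>{..<N}. rank N P a < s} = rank N P ` {..<N} \<inter> {..<s}" by auto
    then show "rank N P ` {a\<in>{..<N}. rank N P a < s} = {..<s}"
      using bij_betw_rank[of N P] assms by (auto simp: bij_betw_def)
  qed
  then show ?thesis using bij_betw_same_card by fastforce
qed

lemma sum_diff_up_to: "q \<le> n \<Longrightarrow> 2 * (\<Sum>l<n. q - l) = q * (q + 1)" for q n :: nat
proof -
  assume "q \<le> n"
  have "(\<Sum>l<n. q - l) = (\<Sum>l<q. q - l)"
    by (rule sum.mono_neutral_right) (use \<open>q \<le> n\<close> in auto)
  moreover have "2 * (\<Sum>l<q. q - l) = q * (q + 1)"
  proof (induction q)
    case (Suc q)
    have "(\<Sum>l<Suc q. Suc q - l) = Suc q + (\<Sum>l<q. q - l)"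
      by (subst sum.lessThan_Suc_shift) simp
    then show ?case using Suc by simp
  qed simp
  ultimately show ?thesis by simp
qed

lemma sum_diff_min:
  fixes q n :: nat
  assumes "2 * q \<le> n"
  shows "(\<Sum>l<n. q - min l (n - 1 - l)) = q * (q + 1)"
proof -
  have "(\<Sum>l<n. q - min l (n - 1 - l)) = (\<Sum>l<n. (q - l) + (q - (n - 1 - l)))"
    by (rule sum.cong) (use assms in \<open>auto simp: min_def\<close>)
  also have "\<dots> = (\<Sum>l<n. q - l) + (\<Sum>l<n. q - (n - Suc l))"
    by (simp add: sum.distrib)
  also have "(\<Sum>l<n. q - (n - Suc l)) = (\<Sum>l<n. q - l)"
    by (rule sum.nat_diff_reindex)
  finally show ?thesis using sum_diff_up_to[of q n] assms by simp
qed

text \<open>Triples counted by their middle element \<open>l\<close>.\<close>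

lemma sum_mult_diff: "(\<Sum>l<n. l * (n - 1 - l)) = n choose 3"
proof (induction n)
  case (Suc n)
  have "(\<Sum>l<Suc n. l * (Suc n - 1 - l)) = (\<Sum>l<n. l * (n - 1 - l)) + (\<Sum>l<n. l)"
  proof -
    have "l * (Suc n - 1 - l) = l * (n - 1 - l) + l" if "l < n" for l
    proof -
      have "Suc n - 1 - l = Suc (n - 1 - l)" using that by simp
      then show ?thesis by (metis add.commute mult_Suc_right)
    qed
    then show ?thesis by (simp flip: sum.distrib)
  qed
  also have "(\<Sum>l<n. l) = n choose 2"
    by (simp add: choose_two lessThan_atLeast0 Sum_Ico_nat)
  also note Suc.IH
  finally show ?case by (simp add: numeral_3_eq_3 numeral_2_eq_2)
qed simp

lemma sum_choose_two: "(\<Sum>l<n. l choose 2) = n choose 3"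
  by (induction n) (simp_all add: numeral_3_eq_3 numeral_2_eq_2)

section \<open>Sides of edges and the effect of a new last vertex\<close>

lemma edges_eq_Sigma: "edges n = (SIGMA i:{1..n}. {i<..n})"
  by (auto simp: edges_def)

lemma finite_edges [simp]: "finite (edges n)"
  by (simp add: edges_eq_Sigma)

lemma sum_edges: "(\<Sum>(i,j)\<in>edges n. f i j) = (\<Sum>i=1..n. \<Sum>j\<in>{i<..n}. f i j)"
  unfolding edges_eq_Sigma by (rule sum.Sigma[symmetric]) auto

lemma sum_edges_Suc:
  "(\<Sum>(i,j)\<in>edges (Suc n). f i j) = (\<Sum>(i,j)\<in>edges n. f i j) + (\<Sum>i=1..n. f i (Suc n))"
proof -
  have "edges (Suc n) = edges n \<union> (\<lambda>i. (i, Suc n)) ` {1..n}"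
    by (auto simp: edges_def image_iff)
  moreover have "edges n \<inter> (\<lambda>i. (i, Suc n)) ` {1..n} = {}"
    by (auto simp: edges_def)
  ultimately have "(\<Sum>(i,j)\<in>edges (Suc n). f i j)
      = (\<Sum>(i,j)\<in>edges n. f i j) + (\<Sum>(i,j)\<in>(\<lambda>i. (i, Suc n)) ` {1..n}. f i j)"
    by (simp add: sum.union_disjoint)
  then show ?thesis by (simp add: sum.reindex inj_on_def)
qed

lemma card_filter_interval_reindex:
  "card {j\<in>{i<..n}. P (j - i - 1)} = card {a\<in>{..<n - i}. P a}" for i n :: nat
  by (rule bij_betw_same_card[of "\<lambda>j. j - i - 1"],
      rule bij_betw_byWitness[of _ "\<lambda>a. i + 1 + a"]) auto

text \<open>The colour of the long edge \<open>ac\<close> decides the orientation of a triangle \<open>a < b < c\<close>. Hence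
  \<open>side c n True i j\<close> and \<open>side c n False i j\<close> count the vertices to the left and to the
  right of the edge \<open>ij\<close>.\<close>
definition side :: "(nat \<Rightarrow> nat \<Rightarrow> bool) \<Rightarrow> nat \<Rightarrow> bool \<Rightarrow> nat \<Rightarrow> nat \<Rightarrow> nat" where
  "side c n b i j = card {k\<in>{1..<i}. c k j = b} + card {k\<in>{j<..n}. c i k = b}
     + (if c i j = b then 0 else j - i - 1)"

lemma side_Suc:
  "j \<le> n \<Longrightarrow> side c (Suc n) b i j = side c n b i j + (if c i (Suc n) = b then 1 else 0)"
proof -
  assume "j \<le> n"
  then have "{k\<in>{j<..Suc n}. c i k = b}
      = (if c i (Suc n) = b then insert (Suc n) {k\<in>{j<..n}. c i k = b} else {k\<in>{j<..n}. c i k = b})"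
    by (auto simp: le_Suc_eq)
  then show ?thesis by (simp add: side_def)
qed

lemma card_filter_add: "finite S \<Longrightarrow> card {k\<in>S. P k} + card {k\<in>S. \<not> P k} = card S"
proof -
  assume "finite S"
  then have "card {k\<in>S. P k} + card {k\<in>S. \<not> P k} = card ({k\<in>S. P k} \<union> {k\<in>S. \<not> P k})"
    by (intro card_Un_disjoint[symmetric]) auto
  also have "{k\<in>S. P k} \<union> {k\<in>S. \<not> P k} = S" by blast
  finally show ?thesis .
qed

lemma side_add:
  assumes "1 \<le> i" "i < j" "j \<le> n"
  shows "side c n True i j + side c n False i j = n - 2"
proof -
  have "card {k\<in>{1..<i}. c k j = True} + card {k\<in>{1..<i}. c k j = False} = i - 1"
    "card {k\<in>{j<..n}. c i k = True} + card {k\<in>{j<..n}. c i k = False} = n - j"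
    using card_filter_add[of "{1..<i}" "\<lambda>k. c k j"] card_filter_add[of "{j<..n}" "c i"] by simp_all
  moreover have "(if c i j = True then 0 else j - i - 1) + (if c i j = False then 0 else j - i - 1)
      = j - i - 1" by simp
  ultimately show ?thesis unfolding side_def using assms by linarith
qed

text \<open>The colours of the last column determine the radial order of the other vertices around
  the last one. This makes its left sides a \<open>rank\<close>, so they run through 0, ..., n -
  1.\<close>

lemma side_last:
  assumes "1 \<le> i" "i \<le> n"
  shows "side c (Suc n) True i (Suc n) = rank n (\<lambda>a. c (n - a) (Suc n)) (n - i)"
proof -
  have "card {k\<in>{1..<i}. c k (Suc n)} = card {a\<in>{n - i<..<n}. c (n - a) (Suc n)}"
    by (rule bij_betw_same_card[of "\<lambda>k. n - k"], rule bij_betw_byWitness[of _ "\<lambda>k. n - k"])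
      (use assms in auto)
  then show ?thesis using assms by (simp add: side_def rank_def)
qed

lemma sum_side_last: "(\<Sum>i=1..n. F (side c (Suc n) True i (Suc n))) = (\<Sum>l<n. F l)"
proof -
  let ?r = "rank n (\<lambda>a. c (n - a) (Suc n))"
  have "(\<Sum>i=1..n. F (side c (Suc n) True i (Suc n))) = (\<Sum>i=1..n. F (?r (n - i)))"
    by (rule sum.cong) (auto simp: side_last)
  also have "\<dots> = (\<Sum>a<n. F (?r a))"
    by (rule sum.reindex_bij_witness[of _ "\<lambda>a. n - a" "\<lambda>i. n - i"]) auto
  also have "\<dots> = (\<Sum>l<n. F l)"
    by (rule sum.reindex_bij_betw[OF bij_betw_rank])
  finally show ?thesis .
qed

lemma side_last_False:
  assumes "1 \<le> i" "i \<le> n"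
  shows "side c (Suc n) False i (Suc n) = n - 1 - side c (Suc n) True i (Suc n)"
  using side_add[of i "Suc n" "Suc n" c] assms by simp

text \<open>The vertices separated by \<open>ij\<close> from the new vertex \<open>Suc n\<close> are counted by
  \<open>above + along\<close>; \<open>along\<close> depends on row \<open>i\<close> only.\<close>
definition above :: "(nat \<Rightarrow> nat \<Rightarrow> bool) \<Rightarrow> nat \<Rightarrow> nat \<Rightarrow> nat \<Rightarrow> nat" where
  "above c n i j = card {k\<in>{1..<i}. c k j \<noteq> c i (Suc n)}"

definition along :: "(nat \<Rightarrow> nat \<Rightarrow> bool) \<Rightarrow> nat \<Rightarrow> nat \<Rightarrow> nat \<Rightarrow> nat" where
  "along c n i j = (if c i j \<noteq> c i (Suc n) then 0 else j - i - 1)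
     + card {k\<in>{j<..n}. c i k \<noteq> c i (Suc n)}"

lemma side_opposite: "side c n (\<not> c i (Suc n)) i j = along c n i j + above c n i j"
  by (simp add: side_def along_def above_def)

lemma above_le: "above c n i j \<le> i - 1"
proof -
  have "above c n i j \<le> card {1..<i}"
    unfolding above_def by (rule card_mono) auto
  then show ?thesis by simp
qed

lemma along_eq_rank:
  assumes "i < j" "j \<le> n"
  shows "along c n i j = rank (n - i) (\<lambda>a. c i (i + 1 + a) \<noteq> c i (Suc n)) (j - i - 1)"
proof -
  have "card {k\<in>{j<..n}. c i k \<noteq> c i (Suc n)}
      = card {a\<in>{j - i - 1<..<n - i}. c i (i + 1 + a) \<noteq> c i (Suc n)}"
    by (rule bij_betw_same_card[of "\<lambda>k. k - i - 1"], rule bij_betw_byWitness[of _ "\<lambda>a. i + 1 + a"])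
      (use assms in auto)
  then show ?thesis using assms by (simp add: along_def rank_def)
qed

lemma card_along_less:
  assumes "s \<le> n - i"
  shows "card {j\<in>{i<..n}. along c n i j < s} = s"
proof -
  let ?r = "rank (n - i) (\<lambda>a. c i (i + 1 + a) \<noteq> c i (Suc n))"
  have "{j\<in>{i<..n}. along c n i j < s} = {j\<in>{i<..n}. ?r (j - i - 1) < s}"
    by (auto simp: along_eq_rank)
  then show ?thesis
    using card_filter_interval_reindex[of i n "\<lambda>a. ?r a < s"] card_rank_less[OF assms] by simp
qed

lemma sum_along: "(\<Sum>j\<in>{i<..n}. along c n i j) = (n - i) choose 2"
proof -
  let ?r = "rank (n - i) (\<lambda>a. c i (i + 1 + a) \<noteq> c i (Suc n))"
  have "(\<Sum>j\<in>{i<..n}. along c n i j) = (\<Sum>j\<in>{i<..n}. ?r (j - i - 1))"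
    by (rule sum.cong) (auto simp: along_eq_rank)
  also have "\<dots> = (\<Sum>a<n - i. ?r a)"
    by (rule sum.reindex_bij_witness[of _ "\<lambda>a. i + 1 + a" "\<lambda>j. j - i - 1"]) auto
  also have "\<dots> = (\<Sum>l<n - i. l)"
    by (rule sum.reindex_bij_betw[OF bij_betw_rank])
  finally show ?thesis by (simp add: choose_two lessThan_atLeast0 Sum_Ico_nat)
qed

section \<open>Lower bounds for the weights and their tightness\<close>

text \<open>\<open>weight c (k + 1) n\<close> is the number of \<open>\<le>\<le>k\<close>-edges.\<close>
definition weight :: "(nat \<Rightarrow> nat \<Rightarrow> bool) \<Rightarrow> nat \<Rightarrow> nat \<Rightarrow> nat" where
  "weight c q n = (\<Sum>(i,j)\<in>edges n. q - min (side c n True i j) (side c n False i j))"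

text \<open>By \<open>side_opposite\<close>, these are the edges of row \<open>i\<close> for which
  the side not receiving the new vertex has fewer than \<open>q\<close> vertices.\<close>

definition near :: "(nat \<Rightarrow> nat \<Rightarrow> bool) \<Rightarrow> nat \<Rightarrow> nat \<Rightarrow> nat \<Rightarrow> nat" where
  "near c n q i = card {j\<in>{i<..n}. along c n i j + above c n i j < q}"

lemma card_filter_eq_sum: "finite S \<Longrightarrow> card {x\<in>S. P x} = (\<Sum>x\<in>S. if P x then 1 else 0)"
  by (simp flip: sum.inter_filter)

text \<open>The edges at the new vertex give \<open>q * (q + 1)\<close>. At an old edge the new
  vertex either enlarges the smaller side, which amounts to replacing \<open>q\<close> by
  \<open>q - 1\<close>, or leaves it alone, which gains one if that side is below \<open>q\<close>.
  Because of \<open>2 * q <= n\<close>, a side below \<open>q\<close> is never the larger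
  one.\<close>

lemma weight_Suc:
  assumes "2 * q \<le> n"
  shows "weight c q (Suc n) = weight c (q - 1) n + (\<Sum>i=1..n. near c n q i) + q * (q + 1)"
proof -
  let ?m = "\<lambda>n i j. min (side c n True i j) (side c n False i j)"
  let ?near = "\<lambda>i j. along c n i j + above c n i j < q"
  have "weight c q (Suc n)
      = (\<Sum>(i,j)\<in>edges n. q - ?m (Suc n) i j) + (\<Sum>i=1..n. q - ?m (Suc n) i (Suc n))"
    unfolding weight_def by (rule sum_edges_Suc)
  also have "(\<Sum>i=1..n. q - ?m (Suc n) i (Suc n)) = q * (q + 1)"
  proof -
    have "(\<Sum>i=1..n. q - ?m (Suc n) i (Suc n))
        = (\<Sum>i=1..n. q - min (side c (Suc n) True i (Suc n)) (n - 1 - side c (Suc n) True i (Suc n)))"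
      by (rule sum.cong) (auto simp: side_last_False)
    also have "\<dots> = (\<Sum>l<n. q - min l (n - 1 - l))"
      by (rule sum_side_last)
    finally show ?thesis using sum_diff_min[OF assms] by simp
  qed
  also have "(\<Sum>(i,j)\<in>edges n. q - ?m (Suc n) i j)
      = (\<Sum>(i,j)\<in>edges n. (q - 1 - ?m n i j) + (if ?near i j then 1 else 0))"
  proof -
    have "q - ?m (Suc n) i j = (q - 1 - ?m n i j) + (if ?near i j then 1 else 0)"
      if "(i, j) \<in> edges n" for i j
    proof -
      from that have ij: "1 \<le> i" "i < j" "j \<le> n" by (auto simp: edges_def)
      then have "side c n True i j + side c n False i j = n - 2" "2 \<le> n"
        using side_add by auto
      then show ?thesis
        using assms ij unfolding side_opposite[symmetric]
        by (cases "c i (Suc n)") (auto simp: side_Suc min_def)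
    qed
    then show ?thesis by (intro sum.cong) auto
  qed
  also have "\<dots> = weight c (q - 1) n + (\<Sum>(i,j)\<in>edges n. if ?near i j then 1 else 0)"
    unfolding weight_def by (simp add: sum.distrib case_prod_unfold)
  also have "(\<Sum>(i,j)\<in>edges n. if ?near i j then 1 else 0) = (\<Sum>i=1..n. near c n q i)"
    unfolding sum_edges near_def by (simp only: card_filter_eq_sum finite_greaterThanAtMost)
  finally show ?thesis .
qed

text \<open>Only \<open>i - 1\<close> vertices precede \<open>i\<close>, so every entry with
  \<open>along\<close> below \<open>q - (i - 1)\<close> is counted, and by
  \<open>card_along_less\<close> there are exactly that many of them.\<close>

lemma near_lower:
  assumes "1 \<le> i" "i \<le> n" "q + 1 \<le> n"
  shows "{j\<in>{i<..n}. along c n i j < q + 1 - i} \<subseteq> {j\<in>{i<..n}. along c n i j + above c n i j < q}"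
    and "q + 1 - i \<le> near c n q i"
proof -
  show *: "{j\<in>{i<..n}. along c n i j < q + 1 - i}
      \<subseteq> {j\<in>{i<..n}. along c n i j + above c n i j < q}"
  proof clarify
    fix j assume "along c n i j < q + 1 - i"
    then show "along c n i j + above c n i j < q"
      using above_le[of c n i j] assms(1) by linarith
  qed
  have "q + 1 - i = card {j\<in>{i<..n}. along c n i j < q + 1 - i}"
    using assms by (intro card_along_less[symmetric]) auto
  also have "\<dots> \<le> near c n q i"
    unfolding near_def by (rule card_mono[OF _ *]) auto
  finally show "q + 1 - i \<le> near c n q i" .
qed

lemma sum_near_lower:
  fixes q n :: nat
  assumes "q \<le> n"
  shows "2 * (\<Sum>i=1..n. q + 1 - i) = q * (q + 1)"
proof -
  have "(\<Sum>i=1..n. q + 1 - i) = (\<Sum>l<n. q - l)"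
    by (simp add: sum.atLeast1_atMost_eq)
  then show ?thesis using sum_diff_up_to[OF assms] by simp
qed

text \<open>The bound is three times \<open>(q + 2) choose 3\<close>. From \<open>q - 1\<close> to
  \<open>q\<close> its double grows by \<open>3 * q * (q + 1)\<close>: two thirds come from the
  edges at the removed vertex, one third from the rows.\<close>

lemma weight_lower: "2 * q < n \<Longrightarrow> q * (q + 1) * (q + 2) \<le> 2 * weight c q n"
proof (induction q arbitrary: n)
  case (Suc q)
  then obtain n' where n: "n = Suc n'" by (cases n) auto
  have "q * (q + 1) * (q + 2) \<le> 2 * weight c q n'"
    using Suc n by auto
  moreover have "(\<Sum>i=1..n'. Suc q + 1 - i) \<le> (\<Sum>i=1..n'. near c n' (Suc q) i)"
    using Suc.prems n near_lower(2)[of _ n' "Suc q" c] by (intro sum_mono) auto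
  then have "Suc q * (Suc q + 1) \<le> 2 * (\<Sum>i=1..n'. near c n' (Suc q) i)"
    using sum_near_lower[of "Suc q" n'] Suc.prems n by auto
  ultimately have "q * (q + 1) * (q + 2) + 3 * (Suc q * (Suc q + 1)) \<le> 2 * weight c (Suc q) n"
    using weight_Suc[of "Suc q" n' c] Suc.prems n by auto
  then show ?case by (simp add: algebra_simps)
qed simp

text \<open>The bounds for the smaller drawing and for the single rows add up to the assumed value,
  so none of them is strict.\<close>

lemma near_eq:
  assumes "2 * weight c q (Suc n) = q * (q + 1) * (q + 2)" "2 * q \<le> n" "1 \<le> q" "1 \<le> i" "i \<le> n"
  shows "near c n q i = q + 1 - i"
proof -
  obtain r where q: "q = Suc r" using assms(3) by (cases q) auto
  have le: "q + 1 - i \<le> near c n q i" if "i \<in> {1..n}" for i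
    using near_lower(2)[of i n q c] that assms by auto
  have "r * (r + 1) * (r + 2) \<le> 2 * weight c (q - 1) n"
    using weight_lower[of r n c] assms q by simp
  moreover have "2 * weight c q (Suc n)
      = 2 * weight c (q - 1) n + 2 * (\<Sum>i=1..n. near c n q i) + 2 * (q * (q + 1))"
    using weight_Suc[OF assms(2), of c] by simp
  ultimately have "2 * (\<Sum>i=1..n. near c n q i) \<le> q * (q + 1)"
    using assms(1) unfolding q by (simp add: algebra_simps)
  then have "(\<Sum>i=1..n. near c n q i) \<le> (\<Sum>i=1..n. q + 1 - i)"
    using sum_near_lower[of q n] assms(2) by simp
  then have "(\<Sum>i=1..n. near c n q i) = (\<Sum>i=1..n. q + 1 - i)"
    using sum_mono[of "{1..n}" "\<lambda>i. q + 1 - i" "near c n q"] le by fastforce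
  then show ?thesis
    using sum_mono_inv[of "\<lambda>i. q + 1 - i" "{1..n}" "near c n q" i] le assms by auto
qed

text \<open>By tightness \<open>near\<close> contains only the entries that
  \<open>near_lower\<close> puts there. An entry with a small total is counted at the
  \<open>q\<close> chosen in the proof, hence has \<open>along < q + 1 - i\<close>, which leaves at
  least \<open>i - 1\<close> for \<open>above\<close>.\<close>

lemma above_full_or_large:
  assumes opt: "\<And>q. \<lbrakk>1 \<le> q; q \<le> m - 1\<rbrakk> \<Longrightarrow> 2 * weight c q (Suc n) = q * (q + 1) * (q + 2)"
    and m: "2 * (m - 1) \<le> n" and i: "1 \<le> i" "i < j" "j \<le> n"
  shows "above c n i j = i - 1 \<or> m - 1 \<le> along c n i j + above c n i j"
proof (rule ccontr)
  assume "\<not> ?thesis"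
  then have a: "above c n i j < i - 1" and small: "along c n i j + above c n i j < m - 1"
    using above_le[of c n i j] by auto
  define q where "q = along c n i j + above c n i j + 1"
  have q: "1 \<le> q" "q \<le> m - 1" "2 * q \<le> n" "q + 1 \<le> n"
    using small m by (auto simp: q_def)
  have "card {j\<in>{i<..n}. along c n i j < q + 1 - i} = q + 1 - i"
    using q i by (intro card_along_less) auto
  moreover have "card {j\<in>{i<..n}. along c n i j + above c n i j < q} = q + 1 - i"
    using near_eq[OF opt[OF q(1,2)] q(3,1)] i by (simp add: near_def)
  ultimately have "{j\<in>{i<..n}. along c n i j < q + 1 - i}
      = {j\<in>{i<..n}. along c n i j + above c n i j < q}"
    using near_lower(1)[of i n q c] q i by (intro card_subset_eq) auto
  moreover have "j \<in> {j\<in>{i<..n}. along c n i j + above c n i j < q}"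
    using i by (simp add: q_def)
  ultimately have "along c n i j < q + 1 - i" by blast
  then show False using a by (simp add: q_def)
qed

section \<open>Crossings in terms of weights\<close>

text \<open>The crossing of \<open>k j\<close> with the new edge at \<open>i\<close> is recorded at
  the old edge \<open>i j\<close>, where \<open>above\<close> counts exactly the remaining
  \<open>k < i\<close>.\<close>

lemma crossings_Suc:
  "crossings (Suc n) D = crossings n D
    + (\<Sum>(i,j)\<in>edges n. card {k\<in>{1..<i}. D (k,j) = D (i, Suc n)})"
proof -
  let ?C = "\<lambda>n. {((i,j),(k,l)). (i,j) \<in> edges n \<and> (k,l) \<in> edges n \<and>
       i < k \<and> k < j \<and> j < l \<and> D (i,j) = D (k,l)}"
  let ?new = "{((k,j),(i,l)). l = Suc n \<and> (i,j) \<in> edges n \<and> k \<in> {1..<i} \<and> D (k,j) = D (i,Suc n)}"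
  have "?C n \<subseteq> edges n \<times> edges n" by auto
  then have fin: "finite (?C n)" by (rule finite_subset) simp
  have bij: "bij_betw (\<lambda>((i,j),k). ((k,j),(i,Suc n)))
      (SIGMA (i,j):edges n. {k\<in>{1..<i}. D (k,j) = D (i,Suc n)}) ?new"
    by (rule bij_betw_byWitness[of _ "\<lambda>((k,j),(i,l)). ((i,j),k)"]) auto
  then have fin': "finite ?new"
    by (rule bij_betw_finite[THEN iffD1]) (auto intro!: finite_SigmaI)
  have "?C (Suc n) = ?C n \<union> ?new"
    by (auto simp: edges_def le_Suc_eq)
  moreover have "?C n \<inter> ?new = {}"
    by (auto simp: edges_def)
  ultimately have "crossings (Suc n) D = crossings n D + card ?new"
    unfolding crossings_def using card_Un_disjoint[OF fin fin'] by simp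
  also have "card ?new = card (SIGMA (i,j):edges n. {k\<in>{1..<i}. D (k,j) = D (i,Suc n)})"
    using bij_betw_same_card[OF bij] by simp
  also have "\<dots> = (\<Sum>(i,j)\<in>edges n. card {k\<in>{1..<i}. D (k,j) = D (i, Suc n)})"
    by (subst card_SigmaI) (auto simp: case_prod_unfold)
  finally show ?thesis .
qed

definition blue :: "drawing \<Rightarrow> nat \<Rightarrow> nat \<Rightarrow> bool" where
  "blue D i j \<longleftrightarrow> D (i,j) = Blue"

lemma colour_eq_iff: "D (i,j) = D (k,l) \<longleftrightarrow> blue D i j = blue D k l"
  unfolding blue_def by (cases "D (i,j)"; cases "D (k,l)") auto

text \<open>Four vertices with a crossing have two separations, without a crossing three. In the
  induction step \<open>n choose 3\<close> arises three times: from the edges at the new vertex,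
  from \<open>along\<close>, and from \<open>above\<close> together with the new crossings.\<close>

lemma crossings_plus_separations:
  "crossings n D + (\<Sum>(i,j)\<in>edges n. side (blue D) n True i j * side (blue D) n False i j)
    = 3 * (n choose 4)"
proof (induction n)
  case 0
  have "edges 0 = {}" by (auto simp: edges_def)
  then show ?case by (simp add: crossings_def case_prod_unfold)
next
  case (Suc n)
  let ?c = "blue D"
  let ?LR = "\<lambda>n i j. side ?c n True i j * side ?c n False i j"
  have "(\<Sum>(i,j)\<in>edges (Suc n). ?LR (Suc n) i j)
      = (\<Sum>(i,j)\<in>edges n. ?LR (Suc n) i j) + (\<Sum>i=1..n. ?LR (Suc n) i (Suc n))"
    by (rule sum_edges_Suc)
  also have "(\<Sum>i=1..n. ?LR (Suc n) i (Suc n)) = n choose 3"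
  proof -
    have "(\<Sum>i=1..n. ?LR (Suc n) i (Suc n))
        = (\<Sum>i=1..n. side ?c (Suc n) True i (Suc n) * (n - 1 - side ?c (Suc n) True i (Suc n)))"
      by (rule sum.cong) (auto simp: side_last_False)
    also have "\<dots> = (\<Sum>l<n. l * (n - 1 - l))" by (rule sum_side_last)
    finally show ?thesis by (simp only: sum_mult_diff)
  qed
  also have "(\<Sum>(i,j)\<in>edges n. ?LR (Suc n) i j)
      = (\<Sum>(i,j)\<in>edges n. ?LR n i j + (along ?c n i j + above ?c n i j))"
  proof -
    have "?LR (Suc n) i j = ?LR n i j + (along ?c n i j + above ?c n i j)" if "(i,j) \<in> edges n" for i j
      using that unfolding side_opposite[symmetric]
      by (cases "?c i (Suc n)") (auto simp: side_Suc edges_def)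
    then show ?thesis by (intro sum.cong) auto
  qed
  also have "\<dots> = (\<Sum>(i,j)\<in>edges n. ?LR n i j) + (\<Sum>(i,j)\<in>edges n. along ?c n i j)
      + (\<Sum>(i,j)\<in>edges n. above ?c n i j)"
    by (simp add: sum.distrib case_prod_unfold)
  also have "(\<Sum>(i,j)\<in>edges n. along ?c n i j) = n choose 3"
  proof -
    have "(\<Sum>(i,j)\<in>edges n. along ?c n i j) = (\<Sum>i=1..n. (n - i) choose 2)"
      unfolding sum_edges by (simp only: sum_along)
    also have "\<dots> = (\<Sum>l<n. (n - Suc l) choose 2)"
      by (simp add: sum.atLeast1_atMost_eq)
    also have "\<dots> = (\<Sum>l<n. l choose 2)"
      by (rule sum.nat_diff_reindex)
    finally show ?thesis by (simp only: sum_choose_two)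
  qed
  finally have LR: "(\<Sum>(i,j)\<in>edges (Suc n). ?LR (Suc n) i j)
      = (\<Sum>(i,j)\<in>edges n. ?LR n i j) + (n choose 3) + (\<Sum>(i,j)\<in>edges n. above ?c n i j)
        + (n choose 3)" .
  have "(\<Sum>(i,j)\<in>edges n. card {k\<in>{1..<i}. D (k,j) = D (i, Suc n)})
      + (\<Sum>(i,j)\<in>edges n. above ?c n i j) = (\<Sum>(i,j)\<in>edges n. i - 1)"
  proof -
    have "card {k\<in>{1..<i}. D (k,j) = D (i, Suc n)} + above ?c n i j = i - 1" for i j
      using card_filter_add[of "{1..<i}" "\<lambda>k. D (k,j) = D (i, Suc n)"]
      by (simp add: above_def colour_eq_iff)
    then show ?thesis by (simp add: case_prod_unfold flip: sum.distrib)
  qed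
  also have "\<dots> = (\<Sum>l<n. l * (n - 1 - l))"
    unfolding sum_edges by (simp add: sum.atLeast1_atMost_eq mult.commute)
  also have "\<dots> = n choose 3" by (rule sum_mult_diff)
  finally show ?case
    using Suc.IH LR crossings_Suc[of n D] by (simp add: numeral_3_eq_3 numeral_eq_Suc)
qed

lemma sum_up_to_diff:
  fixes a M :: nat
  assumes "M \<le> a"
  shows "2 * (\<Sum>q=1..a. q - M) = (a - M) * (a - M + 1)"
proof -
  have "(\<Sum>q=1..a. q - M) = (\<Sum>q\<in>{1+M..a}. q - M)"
    by (rule sum.mono_neutral_right) auto
  also have "\<dots> = (\<Sum>q=1..a - M. q)"
    by (rule sum.reindex_bij_witness[of _ "\<lambda>q. q + M" "\<lambda>q. q - M"]) (use assms in auto)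
  finally show ?thesis
    using double_gauss_sum_from_Suc_0[of "a - M", where 'a = nat] by simp
qed

text \<open>With \<open>M\<close> the smaller side, \<open>L * R = a * b - (a - M) * (b - M)\<close>, and the last
  product is the stated double sum of truncated differences.\<close>
lemma separation_eq:
  fixes a b L R :: nat
  assumes "L + R = a + b" "b = a \<or> b = a + 1"
  shows "L * R + (\<Sum>q=1..a. q - min L R) + (\<Sum>q=1..b - 1. q - min L R) = a * b"
proof -
  define M where "M = min L R"
  define d where "d = a - M"
  have M: "a = M + d" using assms by (auto simp: M_def d_def)
  have LR: "L * R = M * (a + b - M)"
    using assms by (auto simp: M_def min_def)
  have 1: "2 * (\<Sum>q=1..a. q - M) = d * (d + 1)"
    using sum_up_to_diff[of M a] M by simp
  have 2: "2 * (\<Sum>q=1..b - 1. q - M) = (b - 1 - M) * (b - M)"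
  proof (cases "M \<le> b - 1")
    case True
    show ?thesis
    proof (cases b)
      case (Suc b') then show ?thesis using sum_up_to_diff[OF True] True by (auto simp: Suc_diff_le)
    qed (use True in auto)
  next
    case False
    then have "(\<Sum>q=1..b - 1. q - M) = 0" by auto
    then show ?thesis using False by auto
  qed
  have "2 * (L * R) + d * (d + 1) + (b - 1 - M) * (b - M) = 2 * (a * b)"
    using assms(2)
  proof
    assume b: "b = a"
    show ?thesis unfolding LR b M by (cases d) (auto simp: algebra_simps)
  next
    assume b: "b = a + 1"
    show ?thesis unfolding LR b M by (auto simp: algebra_simps)
  qed
  then show ?thesis using 1 2 unfolding M_def[symmetric] by linarith
qed

text \<open>\<open>a\<close> and \<open>b\<close> are the two halves of \<open>n - 2\<close>, so
  \<open>a * b\<close> is the product of the sides of a halving edge and the weights measure the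
  deficit from it.\<close>

lemma crossings_eq_weights:
  assumes "2 \<le> n"
  defines "a \<equiv> n div 2 - 1" and "b \<equiv> n - 1 - n div 2"
  shows "crossings n D + (n choose 2) * (a * b)
    = 3 * (n choose 4) + (\<Sum>q=1..a. weight (blue D) q n) + (\<Sum>q=1..b - 1. weight (blue D) q n)"
proof -
  let ?L = "side (blue D) n True" and ?R = "side (blue D) n False"
  have ab: "a + b = n - 2" "b = a \<or> b = a + 1"
    using assms(1) unfolding a_def b_def by linarith+
  have weights: "(\<Sum>q\<in>S. weight (blue D) q n) = (\<Sum>(i,j)\<in>edges n. \<Sum>q\<in>S. q - min (?L i j) (?R i j))"
    for S unfolding weight_def case_prod_unfold by (rule sum.swap)
  have "(\<Sum>(i,j)\<in>edges n. ?L i j * ?R i j) + (\<Sum>q=1..a. weight (blue D) q n)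
      + (\<Sum>q=1..b - 1. weight (blue D) q n) = (\<Sum>(i,j)\<in>edges n. a * b)"
  proof -
    have "?L i j * ?R i j + (\<Sum>q=1..a. q - min (?L i j) (?R i j))
        + (\<Sum>q=1..b - 1. q - min (?L i j) (?R i j)) = a * b" if "(i,j) \<in> edges n" for i j
      using that ab side_add[of i j n "blue D"] by (intro separation_eq) (auto simp: edges_def)
    then show ?thesis unfolding weights
      by (simp add: case_prod_unfold flip: sum.distrib)
  qed
  also have "\<dots> = (n choose 2) * (a * b)"
  proof -
    have "card (edges n) = (\<Sum>i=1..n. n - i)" by (simp add: edges_eq_Sigma)
    also have "\<dots> = (\<Sum>l<n. n - Suc l)" by (simp add: sum.atLeast1_atMost_eq)
    also have "\<dots> = (\<Sum>l<n. l)" by (rule sum.nat_diff_reindex)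
    finally have "card (edges n) = n choose 2"
      by (simp add: choose_two lessThan_atLeast0 Sum_Ico_nat)
    then show ?thesis by (simp add: case_prod_unfold)
  qed
  finally show ?thesis using crossings_plus_separations[of n D] by linarith
qed

section \<open>Balanced cyclic colourings\<close>

lemma card_interval_le:
  fixes a b :: int
  assumes "{k\<in>S. P k} \<subseteq> {a..b}" and "a \<le> b + 1"
  shows "int (card {k\<in>S. P k}) \<le> b + 1 - a"
  using card_mono[OF _ assms(1)] assms(2) by simp

lemma card_disjoint_filters_le:
  assumes "finite S" "T \<subseteq> S" "\<And>k. P k \<Longrightarrow> \<not> Q k"
  shows "card {k\<in>S. P k} + card {k\<in>T. Q k} \<le> card S"
proof -
  have "finite T" using assms finite_subset by blast
  then have "card {k\<in>S. P k} + card {k\<in>T. Q k} = card ({k\<in>S. P k} \<union> {k\<in>T. Q k})"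
    using assms by (subst card_Un_disjoint) auto
  also have "\<dots> \<le> card S" using assms by (intro card_mono) auto
  finally show ?thesis .
qed

lemma obtain_last:
  fixes j b :: int
  assumes "P j" "j \<le> b"
  obtains y where "j \<le> y" "y \<le> b" "P y" "\<forall>s. y < s \<and> s \<le> b \<longrightarrow> \<not> P s"
proof -
  define B where "B = Collect P \<inter> {j..b}"
  have B: "finite B" "j \<in> B" using assms by (auto simp: B_def)
  then have "Max B \<in> B" using Max_in by blast
  moreover have "\<not> P s" if "Max B < s" "s \<le> b" for s
  proof
    assume "P s"
    with that \<open>Max B \<in> B\<close> have "s \<in> B" by (auto simp: B_def)
    then show False using Max_ge[OF B(1)] that by fastforce
  qed
  ultimately show ?thesis using that[of "Max B"] by (simp add: B_def)
qed

lemma obtain_first: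
  fixes j a :: int
  assumes "P j" "a \<le> j"
  obtains y where "a \<le> y" "y \<le> j" "P y" "\<forall>s. a \<le> s \<and> s < y \<longrightarrow> \<not> P s"
proof -
  have *: "P (- (- j))" "- j \<le> - a" using assms by auto
  obtain y where y: "- j \<le> y" "y \<le> - a" "P (- y)" "\<forall>s. y < s \<and> s \<le> - a \<longrightarrow> \<not> P (- s)"
    by (rule obtain_last[of "\<lambda>k. P (- k)", OF *])
  have "\<not> P s" if "a \<le> s" "s < - y" for s
    using y(4)[rule_format, of "- s"] that by simp
  then show ?thesis using that[of "- y"] y by simp
qed

lemma full_card_imp_all:
  fixes a b :: int
  assumes "int (card {k\<in>{a<..<b}. P k}) \<ge> b - a - 1" and "k \<in> {a<..<b}"
  shows "P k"
proof -
  have "card {a<..<b} \<le> card {k\<in>{a<..<b}. P k}"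
    using assms by simp
  then have "{k\<in>{a<..<b}. P k} = {a<..<b}"
    by (intro card_seteq) auto
  then show ?thesis using assms(2) by blast
qed

lemma card_shift:
  fixes P :: "int \<Rightarrow> bool"
  shows "card {k\<in>{a<..<b}. P (k + t)} = card {k\<in>{a + t<..<b + t}. P k}"
  by (rule bij_betw_same_card[of "\<lambda>k. k + t"], rule bij_betw_byWitness[of _ "\<lambda>k. k - t"]) auto

lemma card_reflect:
  fixes P :: "int \<Rightarrow> bool"
  shows "card {k\<in>{a<..<b}. P (- 1 - k)} = card {k\<in>{- 1 - b<..<- 1 - a}. P k}"
  by (rule bij_betw_same_card[of "\<lambda>k. - 1 - k"], rule bij_betw_byWitness[of _ "\<lambda>k. - 1 - k"]) auto

section \<open>The balance condition and its immediate consequences\<close>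

text \<open>Vertices are integers modulo \<open>n\<close>. The values of \<open>\<chi>\<close> at neighbouring vertices are irrelevant:
  for \<open>y = x + 1\<close> both branches of the conditional vanish.\<close>
locale balanced_colouring =
  fixes n m :: int and \<chi> :: "int \<Rightarrow> int \<Rightarrow> bool"
  assumes sym: "\<chi> a b = \<chi> b a"
    and periodic: "\<chi> (a + n) b = \<chi> a b"
    and balance_up: "\<lbrakk>v < x; x < y; y < v + n\<rbrakk> \<Longrightarrow>
      int (card {k\<in>{v<..<x}. \<chi> k y \<noteq> \<chi> v x}) = x - v - 1 \<or>
      m - 1 \<le> (if \<chi> x y \<noteq> \<chi> v x then 0 else y - x - 1)
        + int (card {s\<in>{y<..<v + n}. \<chi> x s \<noteq> \<chi> v x})
        + int (card {k\<in>{v<..<x}. \<chi> k y \<noteq> \<chi> v x})"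
    and balance_down: "\<lbrakk>v - n < y; y < x; x < v\<rbrakk> \<Longrightarrow>
      int (card {k\<in>{x<..<v}. \<chi> k y \<noteq> \<chi> v x}) = v - x - 1 \<or>
      m - 1 \<le> (if \<chi> x y \<noteq> \<chi> v x then 0 else x - y - 1)
        + int (card {s\<in>{v - n<..<y}. \<chi> x s \<noteq> \<chi> v x})
        + int (card {k\<in>{x<..<v}. \<chi> k y \<noteq> \<chi> v x})"
begin

lemma periodic_simps [simp]:
  "\<chi> (a + n) b = \<chi> a b" "\<chi> (n + a) b = \<chi> a b" "\<chi> (a - n) b = \<chi> a b"
  "\<chi> a (b + n) = \<chi> a b" "\<chi> a (n + b) = \<chi> a b" "\<chi> a (b - n) = \<chi> a b"
  "\<chi> n b = \<chi> 0 b" "\<chi> a n = \<chi> a 0"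
  using periodic[of a b] periodic[of "a - n" b] periodic[of b a] periodic[of "b - n" a]
    periodic[of 0 b] periodic[of 0 a] sym
  by (simp_all add: add.commute)

text \<open>As \<open>x y\<close> differs in colour from \<open>v x\<close>, the conditional in the
  balance condition is zero.\<close>

lemma up_count:
  assumes "v < x" "x < y" "y < v + n" and "\<chi> v x = c" "\<chi> x y = (\<not> c)"
    and "int (card {s\<in>{y<..<v + n}. \<chi> x s \<noteq> c}) \<le> b"
  shows "x - v - 1 \<le> int (card {k\<in>{v<..<x}. \<chi> k y \<noteq> c}) \<or>
    m - 1 \<le> b + int (card {k\<in>{v<..<x}. \<chi> k y \<noteq> c})"
  using balance_up[OF assms(1-3)] assms(4-) by auto

lemma down_count:
  assumes "v - n < y" "y < x" "x < v" and "\<chi> v x = c" "\<chi> x y = (\<not> c)"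
    and "int (card {s\<in>{v - n<..<y}. \<chi> x s \<noteq> c}) \<le> b"
  shows "v - x - 1 \<le> int (card {k\<in>{x<..<v}. \<chi> k y \<noteq> c}) \<or>
    m - 1 \<le> b + int (card {k\<in>{x<..<v}. \<chi> k y \<noteq> c})"
  using balance_down[OF assms(1-3)] assms(4-) by auto

lemma up_count_any:
  assumes "v < x" "x < y" "y < v + n" and "\<chi> v x = c"
    and "int (card {s\<in>{y<..<v + n}. \<chi> x s \<noteq> c}) \<le> b"
  shows "x - v - 1 \<le> int (card {k\<in>{v<..<x}. \<chi> k y \<noteq> c}) \<or>
    m - 1 \<le> y - x - 1 + b + int (card {k\<in>{v<..<x}. \<chi> k y \<noteq> c})"
proof -
  have "(if \<chi> x y \<noteq> c then 0 else y - x - 1) \<le> y - x - 1" using assms(2) by simp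
  with balance_up[OF assms(1-3)] assms(5) show ?thesis unfolding assms(4) by linarith
qed

lemma down_count_any:
  assumes "v - n < y" "y < x" "x < v" and "\<chi> v x = c"
    and "int (card {s\<in>{v - n<..<y}. \<chi> x s \<noteq> c}) \<le> b"
  shows "v - x - 1 \<le> int (card {k\<in>{x<..<v}. \<chi> k y \<noteq> c}) \<or>
    m - 1 \<le> x - y - 1 + b + int (card {k\<in>{x<..<v}. \<chi> k y \<noteq> c})"
proof -
  have "(if \<chi> x y \<noteq> c then 0 else x - y - 1) \<le> x - y - 1" using assms(2) by simp
  with balance_down[OF assms(1-3)] assms(5) show ?thesis unfolding assms(4) by linarith
qed

lemma up_count_length:
  assumes "v < x" "x < y" "y < v + n" and "\<chi> v x = c" "\<chi> x y = (\<not> c)"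
  shows "x - v - 1 \<le> int (card {k\<in>{v<..<x}. \<chi> k y \<noteq> c}) \<or>
    m - 1 \<le> v + n - y - 1 + int (card {k\<in>{v<..<x}. \<chi> k y \<noteq> c})"
proof (rule up_count[OF assms])
  have "int (card {s\<in>{y<..<v + n}. \<chi> x s \<noteq> c}) \<le> v + n - 1 + 1 - (y + 1)"
    by (rule card_interval_le) (use assms(3) in auto)
  then show "int (card {s\<in>{y<..<v + n}. \<chi> x s \<noteq> c}) \<le> v + n - y - 1" by linarith
qed

lemma down_count_length:
  assumes "v - n < y" "y < x" "x < v" and "\<chi> v x = c" "\<chi> x y = (\<not> c)"
  shows "v - x - 1 \<le> int (card {k\<in>{x<..<v}. \<chi> k y \<noteq> c}) \<or>
    m - 1 \<le> y - (v - n) - 1 + int (card {k\<in>{x<..<v}. \<chi> k y \<noteq> c})"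
proof (rule down_count[OF assms])
  have "int (card {s\<in>{v - n<..<y}. \<chi> x s \<noteq> c}) \<le> y - 1 + 1 - (v - n + 1)"
    by (rule card_interval_le) (use assms(1) in auto)
  then show "int (card {s\<in>{v - n<..<y}. \<chi> x s \<noteq> c}) \<le> y - (v - n) - 1" by linarith
qed

text \<open>The length bound makes the second alternative of \<open>up_count_length\<close> as
  strong as the first, so no chord from the arc between \<open>v\<close> and \<open>x\<close> to
  \<open>y\<close> is an exception.\<close>

lemma up_all:
  assumes "v < x" "x < y" "y < v + n" and "\<chi> v x = c" "\<chi> x y = (\<not> c)"
    and "x + n - y \<le> m + 1" and "v < k" "k < x"
  shows "\<chi> k y = (\<not> c)"
  using up_count_length[OF assms(1-5)] assms(6-) full_card_imp_all[of x v "\<lambda>k. \<chi> k y \<noteq> c" k]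
  by auto

lemma down_all:
  assumes "v - n < y" "y < x" "x < v" and "\<chi> v x = c" "\<chi> x y = (\<not> c)"
    and "n + y - x \<le> m + 1" and "x < k" "k < v"
  shows "\<chi> k y = (\<not> c)"
  using down_count_length[OF assms(1-5)] assms(6-) full_card_imp_all[of v x "\<lambda>k. \<chi> k y \<noteq> c" k]
  by auto

text \<open>Since \<open>y\<close> is the last vertex before \<open>v + n\<close> whose chord to
  \<open>x\<close> is not \<open>c\<close>, only the chords ending in \<open>y\<close> remain in the
  balance condition.\<close>

lemma up_first:
  assumes "v < x" "x < y" "y < v + n" and "\<chi> v x = c" "\<chi> x y = (\<not> c)"
    and "\<And>s. \<lbrakk>y < s; s < v + n\<rbrakk> \<Longrightarrow> \<chi> x s = c"
  shows "min (x - v - 1) (m - 1) \<le> int (card {k\<in>{v<..<x}. \<chi> k y \<noteq> c})"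
proof -
  have "{s\<in>{y<..<v + n}. \<chi> x s \<noteq> c} = {}" using assms(6) by auto
  then have "int (card {s\<in>{y<..<v + n}. \<chi> x s \<noteq> c}) \<le> 0" by (simp only: card.empty)
  from up_count[OF assms(1-5) this] show ?thesis by auto
qed

lemma down_first:
  assumes "v - n < y" "y < x" "x < v" and "\<chi> v x = c" "\<chi> x y = (\<not> c)"
    and "\<And>s. \<lbrakk>v - n < s; s < y\<rbrakk> \<Longrightarrow> \<chi> x s = c"
  shows "min (v - x - 1) (m - 1) \<le> int (card {k\<in>{x<..<v}. \<chi> k y \<noteq> c})"
proof -
  have "{s\<in>{v - n<..<y}. \<chi> x s \<noteq> c} = {}" using assms(6) by auto
  then have "int (card {s\<in>{v - n<..<y}. \<chi> x s \<noteq> c}) \<le> 0" by (simp only: card.empty)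
  from down_count[OF assms(1-5) this] show ?thesis by auto
qed

end

section \<open>Colours forced by a corner\<close>

text \<open>Here \<open>n = 2 * m + e\<close>, and \<open>p\<close>, \<open>p + 1\<close> are consecutive vertices opposite to \<open>0\<close>.\<close>
locale cornered_colouring = balanced_colouring +
  fixes p e :: int
  assumes n_eq: "n = m + p + 1" and p_eq: "p = m - 1 + e" and e_cases: "e = 0 \<or> e = 1"
    and m_ge: "3 \<le> m"
    and corner: "\<chi> 0 p" "\<not> \<chi> 0 (p + 1)"
    and tip: "e = 1 \<Longrightarrow> \<chi> (- 1) 1"
begin

text \<open>Stated as strict bounds rather than equations, so that \<open>n\<close> is not
  substituted away and \<open>periodic_simps\<close> stays applicable.\<close>

lemma params: "n < m + p + 2" "m + p < n" "p < m + e" "m + e < p + 2"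
  "0 \<le> e" "e \<le> 1" "3 \<le> m"
  using n_eq p_eq e_cases m_ge by auto

lemma corner': "\<chi> p 0" "\<not> \<chi> (p + 1) 0"
  using corner sym by blast+

text \<open>The path from \<open>p + 1\<close> to \<open>n\<close>, a copy of 0, and on to
  \<open>n + p\<close> changes from red to blue, and \<open>n - p = m + 1\<close> is the largest
  value that \<open>up_all\<close> admits.\<close>

lemma fan_p:
  assumes "p + 2 \<le> k" "k \<le> n - 1"
  shows "\<chi> k p"
proof -
  have "\<chi> k (n + p) = (\<not> False)"
    by (rule up_all[where v = "p + 1" and x = n]) (use assms params corner corner' in auto)
  then show ?thesis by simp
qed

lemma fan_Suc_p:
  assumes "1 \<le> k" "k \<le> p - 1"
  shows "\<not> \<chi> k (p + 1)"
proof -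
  have "\<chi> k (p + 1 - n) = (\<not> True)"
    by (rule down_all[where v = p and x = 0]) (use assms params corner corner' in auto)
  then show ?thesis by simp
qed

text \<open>By \<open>fan_p\<close> the chords from \<open>p\<close> to vertices beyond
  \<open>j\<close> have the colour of \<open>0 p\<close>. Hence at most \<open>j - p - 1\<close> is
  added to the count in the balance condition for \<open>0\<close>, \<open>p\<close>,
  \<open>j\<close>. The mirror image is \<open>row_count\<close>.\<close>

lemma column_count:
  assumes "p + 1 \<le> j" "j \<le> n - 1"
  shows "p - 1 \<le> int (card {k\<in>{0<..<p}. \<not> \<chi> k j}) \<or>
    n - 1 - j \<le> int (card {k\<in>{0<..<p}. \<not> \<chi> k j})"
proof -
  have "{s\<in>{j<..<0 + n}. \<chi> p s \<noteq> True} = {}"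
    using fan_p sym[of p] assms by fastforce
  then have "int (card {s\<in>{j<..<0 + n}. \<chi> p s \<noteq> True}) \<le> 0"
    by (simp only: card.empty)
  then have "p - 0 - 1 \<le> int (card {k\<in>{0<..<p}. \<chi> k j \<noteq> True}) \<or>
    m - 1 \<le> j - p - 1 + 0 + int (card {k\<in>{0<..<p}. \<chi> k j \<noteq> True})"
    by (rule up_count_any[rotated -1]) (use assms params corner in auto)
  then show ?thesis using params by auto
qed

lemma row_count:
  assumes "1 \<le> k" "k \<le> p"
  shows "m - 1 \<le> int (card {s\<in>{p + 1<..<n}. \<chi> s k}) \<or>
    m - 1 - p + k \<le> int (card {s\<in>{p + 1<..<n}. \<chi> s k})"
proof -
  have "{s\<in>{n - n<..<k}. \<chi> (p + 1) s \<noteq> False} = {}"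
    using fan_Suc_p sym[of "p + 1"] assms by fastforce
  then have "int (card {s\<in>{n - n<..<k}. \<chi> (p + 1) s \<noteq> False}) \<le> 0"
    by (simp only: card.empty)
  then have "n - (p + 1) - 1 \<le> int (card {s\<in>{p + 1<..<n}. \<chi> s k \<noteq> False}) \<or>
    m - 1 \<le> p + 1 - k - 1 + 0 + int (card {s\<in>{p + 1<..<n}. \<chi> s k \<noteq> False})"
    by (rule down_count_any[rotated -1]) (use assms params corner in auto)
  then show ?thesis using params by auto
qed

text \<open>After a last red chord \<open>0 y\<close>, \<open>up_first\<close> makes at least
  \<open>m - 1\<close> of the \<open>m\<close> chords from \<open>y\<close> to the vertices
  \<open>p + 1\<close>, ..., \<open>n - 1\<close> red, while \<open>row_count\<close> asks for
  \<open>min (m - 1) (y - e)\<close> blue ones. Two are too many, hence the bound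
  \<open>2 + e\<close>.\<close>

lemma row0_blue:
  assumes "2 + e \<le> j" "j \<le> p"
  shows "\<chi> 0 j"
proof (rule ccontr)
  assume "\<not> \<chi> 0 j"
  obtain y where "j \<le> y" "y \<le> p" "\<not> \<chi> 0 y"
    and "\<forall>s. y < s \<and> s \<le> p \<longrightarrow> \<not> \<not> \<chi> 0 s"
    by (rule obtain_last[of "\<lambda>j. \<not> \<chi> 0 j", OF \<open>\<not> \<chi> 0 j\<close> assms(2)])
  then have y: "2 + e \<le> y" "y \<le> p" "\<not> \<chi> 0 y"
    and above: "\<forall>s. y < s \<and> s \<le> p \<longrightarrow> \<chi> 0 s" using assms(1) by auto
  have "y \<noteq> p" using corner y by auto
  have "min (n - p - 1) (m - 1) \<le> int (card {k\<in>{p<..<n}. \<chi> k (n + y) \<noteq> True})"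
  proof (rule up_first)
    show "\<chi> n s = True" if "n + y < s" "s < p + n" for s
      using above[rule_format, of "s - n"] that by simp
  qed (use y \<open>y \<noteq> p\<close> params corner corner' in auto)
  then have "m - 1 \<le> int (card {k\<in>{p<..<n}. \<not> \<chi> k y})"
    using params by simp
  moreover have "card {k\<in>{p<..<n}. \<not> \<chi> k y} + card {s\<in>{p + 1<..<n}. \<chi> s y} \<le> card {p<..<n}"
    by (rule card_disjoint_filters_le) auto
  ultimately show False using row_count[of y] y params by auto
qed

text \<open>Mirror image of \<open>row0_blue\<close>: \<open>p - e\<close> blue and
  \<open>1 + e\<close> red chords do not fit on the \<open>p\<close> vertices from 1 to
  \<open>p\<close>. For odd \<open>n\<close> the entry \<open>n - 2\<close> is not reached.\<close>

lemma row0_red_part: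
  assumes "p + 1 \<le> j" "j \<le> n - 2 - e"
  shows "\<not> \<chi> 0 j"
proof
  assume "\<chi> 0 j"
  obtain y where "p + 1 \<le> y" "y \<le> j" "\<chi> 0 y"
    and below: "\<forall>s. p + 1 \<le> s \<and> s < y \<longrightarrow> \<not> \<chi> 0 s"
    by (rule obtain_first[of "\<chi> 0", OF \<open>\<chi> 0 j\<close> assms(1)])
  then have y: "p + 1 \<le> y" "y \<le> n - 2 - e" "\<chi> 0 y" using assms(2) by linarith+
  have "y \<noteq> p + 1" using corner y by auto
  have "min (p + 1 - 0 - 1) (m - 1) \<le> int (card {k\<in>{0<..<p + 1}. \<chi> k (y - n) \<noteq> False})"
  proof (rule down_first)
    show "\<chi> 0 s = False" if "p + 1 - n < s" "s < y - n" for s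
      using below[rule_format, of "s + n"] that by simp
  qed (use y \<open>y \<noteq> p + 1\<close> params corner corner' in auto)
  then have "p - e \<le> int (card {k\<in>{0<..<p + 1}. \<chi> k y})"
    using params by auto
  moreover have "card {k\<in>{0<..<p + 1}. \<chi> k y} + card {k\<in>{0<..<p}. \<not> \<chi> k y}
      \<le> card {0<..<p + 1}"
    by (rule card_disjoint_filters_le) auto
  ultimately show False using column_count[of y] y params by auto
qed

text \<open>By \<open>row_count\<close> vertex \<open>1 + e\<close> has a blue chord to the other
  half. The last one ends before \<open>n - 1\<close> because the tip is red, and
  \<open>up_first\<close> seen from \<open>- 1\<close> spreads its colour to the vertices 0, ...,
  \<open>e\<close>.\<close>

lemma red_tip_witness:
  assumes "\<not> \<chi> (- 1) (1 + e)"
  obtains j where "p + 2 \<le> j" "j \<le> n - 2" "\<forall>k. 0 \<le> k \<and> k \<le> 1 + e \<longrightarrow> \<chi> k j"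
proof -
  have "1 \<le> int (card {s\<in>{p + 1<..<n}. \<chi> s (1 + e)})"
    using row_count[of "1 + e"] params by auto
  then have "{s\<in>{p + 1<..<n}. \<chi> s (1 + e)} \<noteq> {}"
    by (metis card.empty int_ops(1) not_one_le_zero)
  then obtain i where i: "p + 1 < i" "i \<le> n - 1" "\<chi> i (1 + e)" by auto
  obtain j where "i \<le> j" and j: "j \<le> n - 1" "\<chi> j (1 + e)"
    and above: "\<forall>s. j < s \<and> s \<le> n - 1 \<longrightarrow> \<not> \<chi> s (1 + e)"
    by (rule obtain_last[of "\<lambda>s. \<chi> s (1 + e)", OF i(3) i(2)])
  then have j1: "p + 2 \<le> j" using i by simp
  have "\<not> \<chi> (n + - 1) (1 + e)" using assms unfolding periodic_simps .
  then have "j \<noteq> n - 1" using j(2) by auto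
  with j have j2: "j \<le> n - 2" by simp
  have j3: "\<chi> (1 + e) j" using j(2) sym by blast
  have "min (1 + e - - 1 - 1) (m - 1) \<le> int (card {k\<in>{- 1<..<1 + e}. \<chi> k j \<noteq> False})"
  proof (rule up_first)
    show "\<chi> (1 + e) s = False" if "j < s" "s < - 1 + n" for s
      using above[rule_format, of s] that sym[of s "1 + e"] by simp
  qed (use assms j1 j2 j3 params in auto)
  then have "\<chi> k j" if "0 \<le> k" "k \<le> e" for k
    using full_card_imp_all[of "1 + e" "- 1" "\<lambda>k. \<chi> k j" k] that params by auto
  then have "\<chi> k j" if "0 \<le> k" "k \<le> 1 + e" for k
    using j3 that by (cases "k = 1 + e") auto
  then show ?thesis using that[OF j1 j2] by blast
qed

lemma row0_red_last:
  assumes e: "e = 1"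
  shows "\<not> \<chi> 0 (n - 2)"
proof
  assume J: "\<chi> 0 (n - 2)"
  have J': "\<chi> (- 2) 0 = True"
    using J sym[of 0 "- 2"] periodic_simps(5)[of 0 "- 2"] by simp
  have le: "int (card {s\<in>{a<..<- 2 + n}. \<chi> 0 s \<noteq> True}) \<le> m - 2" if "1 \<le> a" "a = 2 \<or> \<chi> 0 2" for a
  proof -
    have "{s\<in>{a<..<- 2 + n}. \<chi> 0 s \<noteq> True} \<subseteq> {p + 1..n - 3}"
    proof
      fix s assume s: "s \<in> {s\<in>{a<..<- 2 + n}. \<chi> 0 s \<noteq> True}"
      then have "s \<noteq> 2" using that by auto
      then show "s \<in> {p + 1..n - 3}" using s row0_blue[of s] e that by force
    qed
    from card_interval_le[OF this] show ?thesis using params e by simp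
  qed
  \<comment> \<open>Otherwise the balance condition for \<open>- 2\<close>, \<open>0\<close>,
    \<open>1\<close> makes the chord from \<open>- 1\<close> to \<open>1\<close> red, against
    \<open>tip\<close>.\<close>
  have "\<not> \<chi> 0 2"
  proof
    assume "\<chi> 0 2"
    then have "int (card {s\<in>{1<..<- 2 + n}. \<chi> 0 s \<noteq> True}) \<le> m - 2" using le[of 1] by simp
    then have "0 - - 2 - 1 \<le> int (card {k\<in>{- 2<..<0}. \<chi> k 1 \<noteq> True}) \<or>
      m - 1 \<le> 1 - 0 - 1 + (m - 2) + int (card {k\<in>{- 2<..<0}. \<chi> k 1 \<noteq> True})"
      by (rule up_count_any[rotated -1]) (use J' params in auto)
    then have "0 < card {k\<in>{- 2<..<0}. \<chi> k 1 \<noteq> True}" by auto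
    then obtain k where "k \<in> {- 2<..<0}" "\<not> \<chi> k 1" by (auto simp: card_gt_0_iff)
    moreover from this have "k = - 1" by simp
    ultimately show False using tip e by simp
  qed
  moreover have "int (card {s\<in>{2<..<- 2 + n}. \<chi> 0 s \<noteq> True}) \<le> m - 2" using le[of 2] by simp
  ultimately have "0 - - 2 - 1 \<le> int (card {k\<in>{- 2<..<0}. \<chi> k 2 \<noteq> True}) \<or>
      m - 1 \<le> m - 2 + int (card {k\<in>{- 2<..<0}. \<chi> k 2 \<noteq> True})"
    by (intro up_count) (use J' params in auto)
  then have "0 < card {k\<in>{- 2<..<0}. \<chi> k 2 \<noteq> True}" by auto
  then obtain k where "k \<in> {- 2<..<0}" "\<not> \<chi> k 2" by (auto simp: card_gt_0_iff)
  moreover from this have "k = - 1" by simp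
  ultimately have "\<not> \<chi> (- 1) (1 + e)" using e by simp
  then obtain j where j: "p + 2 \<le> j" "j \<le> n - 2" "\<forall>k. 0 \<le> k \<and> k \<le> 1 + e \<longrightarrow> \<chi> k j"
    using red_tip_witness by blast
  \<comment> \<open>Column \<open>j\<close> is blue in row 0, and \<open>n - 2\<close> is the only
    column of the right half before \<open>n - 1\<close> where this is not yet excluded.\<close>
  then have jJ: "j = n - 2"
    using row0_red_part[of j] e by force
  have "1 \<le> int (card {k\<in>{0<..<p}. \<not> \<chi> k (n - 2)})"
    using column_count[of "n - 2"] params e by auto
  then have "{k\<in>{0<..<p}. \<not> \<chi> k (n - 2)} \<noteq> {}"
    by (metis card.empty int_ops(1) not_one_le_zero)
  then obtain k where k: "0 < k" "k < p" "\<not> \<chi> k (n - 2)" by auto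
  with j(3)[rule_format, of k] jJ e have k3: "3 \<le> k" by force
  \<comment> \<open>The blue chords at 0 that are counted here end at most at \<open>p\<close>, so
    there are at most \<open>p - k\<close>; with \<open>p = m\<close> and \<open>k >= 3\<close> both
    alternatives fail.\<close>
  have "n - 2 - k - 1 \<le> int (card {s\<in>{k<..<n - 2}. \<chi> s 0 \<noteq> False}) \<or>
    m - 1 \<le> 0 - (n - 2 - n) - 1 + int (card {s\<in>{k<..<n - 2}. \<chi> s 0 \<noteq> False})"
    by (rule down_count_length) (use k k3 e params row0_blue[of k] sym[of k] in auto)
  moreover have "s \<le> p" if "s < n - 2" "\<chi> s 0" for s
    using row0_red_part[of s] that sym[of s 0] e by force
  then have "int (card {s\<in>{k<..<n - 2}. \<chi> s 0 \<noteq> False}) \<le> p + 1 - (k + 1)"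
    by (intro card_interval_le) (use k in auto)
  ultimately show False using k3 params e by auto
qed

lemma row0_red:
  assumes "p + 1 \<le> j" "j \<le> n - 2"
  shows "\<not> \<chi> 0 j"
  using assms row0_red_part[of j] row0_red_last e_cases by (cases "j = n - 2") auto

lemma tip_blue: "\<chi> (n - 1) (1 + e)"
proof (rule ccontr)
  assume "\<not> \<chi> (n - 1) (1 + e)"
  then have "\<not> \<chi> (- 1) (1 + e)"
    using periodic_simps(2)[of "- 1" "1 + e"] by simp
  then obtain j where "p + 2 \<le> j" "j \<le> n - 2" "\<forall>k. 0 \<le> k \<and> k \<le> 1 + e \<longrightarrow> \<chi> k j"
    using red_tip_witness by blast
  then show False using row0_red[of j] params by auto
qed

text \<open>If \<open>u z\<close> were blue, the path from \<open>u\<close> over \<open>z\<close> to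
  0 would change to red. Between \<open>u\<close> and \<open>z\<close> only vertices after
  \<open>p\<close> have red chords to 0, and these \<open>z - 1 - p\<close> are too few while
  \<open>u + z < n\<close>. For \<open>u = e = 1\<close> vertex 2 may add one more, hence the
  stronger bound on \<open>z\<close>.\<close>

lemma rectangle_red:
  assumes "1 \<le> u" "u \<le> p" "p + 1 \<le> z" "z \<le> n - 2" "u + 2 \<le> z" "u + z \<le> n - 1"
    and "1 + e \<le> u \<or> z \<le> n - 3"
  shows "\<not> \<chi> u z"
proof
  assume uz: "\<chi> u z"
  have cnt: "z - u - 1 \<le> int (card {k\<in>{u<..<z}. \<chi> k n \<noteq> True}) \<or>
    m - 1 \<le> u + n - n - 1 + int (card {k\<in>{u<..<z}. \<chi> k n \<noteq> True})"
    by (rule up_count_length) (use uz assms params row0_red[of z] sym[of z 0] in auto)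
  show False
  proof (cases "1 + e \<le> u")
    case True
    have "p < k" if "u < k" "\<not> \<chi> k 0" for k
      using row0_blue[of k] that True sym[of k 0] by force
    then have "int (card {k\<in>{u<..<z}. \<chi> k n \<noteq> True}) \<le> z - 1 + 1 - (p + 1)"
      by (intro card_interval_le) (use assms in force)+
    with cnt assms params show False by auto
  next
    case False
    then have e: "e = 1" "u = 1" using assms e_cases by auto
    have "k = 2 \<or> p < k" if "u < k" "\<not> \<chi> k 0" for k
      using row0_blue[of k] that e sym[of k 0] by force
    then have "{k\<in>{u<..<z}. \<chi> k n \<noteq> True} \<subseteq> insert 2 {p + 1..z - 1}"
      by force
    then have "card {k\<in>{u<..<z}. \<chi> k n \<noteq> True} \<le> card (insert 2 {p + 1..z - 1})"
      by (rule card_mono[rotated]) simp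
    also have "\<dots> \<le> Suc (card {p + 1..z - 1})"
      by (simp add: card_insert_if)
    finally show False using cnt assms False params e by auto
  qed
qed

text \<open>Mirror image of \<open>rectangle_red\<close>, with at most \<open>p - u\<close> blue
  chords; \<open>p = m - 1 + e\<close> moves the border to \<open>n + e\<close>. At
  \<open>u = 1 + e\<close>, where \<open>row0_blue\<close> gives nothing, the only entry is the
  tip.\<close>

lemma rectangle_blue:
  assumes "1 + e \<le> u" "u \<le> p" "p + 1 \<le> z" "z \<le> n - 1" "n + e \<le> u + z"
  shows "\<chi> u z"
proof (cases "u = 1 + e")
  case True
  then have "z = n - 1" using assms by simp
  then show ?thesis using tip_blue True sym[of "1 + e"] by simp
next
  case False
  show ?thesis
  proof (rule ccontr)
    assume uz: "\<not> \<chi> u z"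
    have "z - u - 1 \<le> int (card {k\<in>{u<..<z}. \<chi> k 0 \<noteq> False}) \<or>
      m - 1 \<le> 0 - (z - n) - 1 + int (card {k\<in>{u<..<z}. \<chi> k 0 \<noteq> False})"
      by (rule down_count_length) (use uz assms False params row0_blue[of u] sym[of u] in auto)
    moreover have "k \<le> p" if "k < z" "\<chi> k 0" for k
      using row0_red[of k] that assms sym[of k 0] by force
    then have "int (card {k\<in>{u<..<z}. \<chi> k 0 \<noteq> False}) \<le> p + 1 - (u + 1)"
      by (intro card_interval_le) (use assms in auto)
    ultimately show False using assms params by auto
  qed
qed

text \<open>The pivot \<open>n - 2 - k\<close> puts \<open>k + 1\<close> on the border
  \<open>u + z = n - 1\<close> of the red region, while \<open>y\<close> still meets it in the blue
  one; \<open>down_all\<close> from \<open>k + 1\<close> then reaches \<open>k\<close>. The red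
  lemmas use the pivot \<open>n + e + 1 - w\<close>, which together with \<open>w - 1\<close> lies
  on the border \<open>n + e\<close> of the blue region.\<close>

lemma left_blue:
  assumes "1 \<le> k" "k + 2 + e \<le> y" "k + y \<le> m - 1"
  shows "\<chi> k y"
proof -
  have "\<not> \<chi> (k + 1) (n - 2 - k)"
    by (rule rectangle_red) (use assms params in auto)
  then have a: "\<chi> (k + 1) (- 2 - k) = False"
    using periodic_simps(5)[of "k + 1" "- 2 - k"] by (simp add: algebra_simps)
  have "\<chi> y (n - 2 - k)"
    by (rule rectangle_blue) (use assms params in auto)
  then have b: "\<chi> (- 2 - k) (y - n) = (\<not> False)"
    using periodic_simps(5)[of y "- 2 - k"] sym[of y "- 2 - k"] by (simp add: algebra_simps)
  have "\<chi> k (y - n) = (\<not> False)"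
    by (rule down_all[OF _ _ _ a b]) (use assms params in auto)
  then show ?thesis by simp
qed

lemma left_red:
  assumes "1 \<le> y" "y + 3 \<le> w" "w \<le> p" "p + 1 + e \<le> y + w"
  shows "\<not> \<chi> y w"
proof -
  have a: "\<chi> (w - 1) (n + e + 1 - w) = True"
    using rectangle_blue[of "w - 1" "n + e + 1 - w"] assms params by auto
  have b: "\<chi> (n + e + 1 - w) (n + y) = (\<not> True)"
    using rectangle_red[of y "n + e + 1 - w"] assms params sym[of y] by auto
  have "\<chi> w (n + y) = (\<not> True)"
    by (rule up_all[OF _ _ _ a b]) (use assms params in auto)
  then show ?thesis using sym[of y w] by simp
qed

lemma right_blue:
  assumes "p + 1 \<le> k" "k + 2 + e \<le> y" "y \<le> n - 1" "k + y \<le> n + m - 1"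
  shows "\<chi> k y"
proof -
  have a: "\<chi> (k + 1) (n - 2 - k) = False"
    using rectangle_red[of "n - 2 - k" "k + 1"] assms params sym[of "k + 1"] by auto
  have b: "\<chi> (n - 2 - k) (y - n) = (\<not> False)"
    using rectangle_blue[of "n - 2 - k" y] assms params by auto
  have "\<chi> k (y - n) = (\<not> False)"
    by (rule down_all[OF _ _ _ a b]) (use assms params in auto)
  then show ?thesis by simp
qed

lemma right_red:
  assumes "p + 1 \<le> y" "y + 3 \<le> w" "w \<le> n - 1" "n + p + 1 + e \<le> y + w"
  shows "\<not> \<chi> y w"
proof -
  have a: "\<chi> (w - 1) (n + (n + e + 1 - w)) = True"
    using rectangle_blue[of "n + e + 1 - w" "w - 1"] assms params sym[of "w - 1"]
    unfolding periodic_simps by auto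
  have b: "\<chi> (n + (n + e + 1 - w)) (n + y) = (\<not> True)"
    using rectangle_red[of "n + e + 1 - w" y] assms params unfolding periodic_simps by auto
  have "\<chi> w (n + y) = (\<not> True)"
    by (rule up_all[OF _ _ _ a b]) (use assms params in auto)
  then show ?thesis using sym[of y w] by simp
qed

end

section \<open>Symmetries and the existence of a corner\<close>

context balanced_colouring
begin

lemma balanced_shift: "balanced_colouring n m (\<lambda>a b. \<chi> (a + t) (b + t))"
proof
  fix a b v x y :: int
  show "\<chi> (a + t) (b + t) = \<chi> (b + t) (a + t)" by (rule sym)
  show "\<chi> (a + n + t) (b + t) = \<chi> (a + t) (b + t)"
    using periodic[of "a + t"] by (simp add: algebra_simps)
  show "int (card {k\<in>{v<..<x}. \<chi> (k + t) (y + t) \<noteq> \<chi> (v + t) (x + t)}) = x - v - 1 \<or>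
      m - 1 \<le> (if \<chi> (x + t) (y + t) \<noteq> \<chi> (v + t) (x + t) then 0 else y - x - 1)
        + int (card {s\<in>{y<..<v + n}. \<chi> (x + t) (s + t) \<noteq> \<chi> (v + t) (x + t)})
        + int (card {k\<in>{v<..<x}. \<chi> (k + t) (y + t) \<noteq> \<chi> (v + t) (x + t)})"
    if "v < x" "x < y" "y < v + n"
    using balance_up[of "v + t" "x + t" "y + t"] that
    unfolding card_shift[of v x "\<lambda>k. \<chi> k (y + t) \<noteq> \<chi> (v + t) (x + t)" t]
      card_shift[of y "v + n" "\<lambda>s. \<chi> (x + t) s \<noteq> \<chi> (v + t) (x + t)" t]
    by (simp add: algebra_simps split: if_split_asm)
  show "int (card {k\<in>{x<..<v}. \<chi> (k + t) (y + t) \<noteq> \<chi> (v + t) (x + t)}) = v - x - 1 \<or>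
      m - 1 \<le> (if \<chi> (x + t) (y + t) \<noteq> \<chi> (v + t) (x + t) then 0 else x - y - 1)
        + int (card {s\<in>{v - n<..<y}. \<chi> (x + t) (s + t) \<noteq> \<chi> (v + t) (x + t)})
        + int (card {k\<in>{x<..<v}. \<chi> (k + t) (y + t) \<noteq> \<chi> (v + t) (x + t)})"
    if "v - n < y" "y < x" "x < v"
    using balance_down[of "v + t" "y + t" "x + t"] that
    unfolding card_shift[of x v "\<lambda>k. \<chi> k (y + t) \<noteq> \<chi> (v + t) (x + t)" t]
      card_shift[of "v - n" y "\<lambda>s. \<chi> (x + t) s \<noteq> \<chi> (v + t) (x + t)" t]
    by (simp add: algebra_simps split: if_split_asm)
qed

lemma balanced_reflect: "balanced_colouring n m (\<lambda>a b. \<chi> (- a) (- b))"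
proof
  have image: "{k\<in>{a<..<b}. P (- k)} = uminus ` {k\<in>{- b<..<- a}. P k}" for a b :: int and P
    by (force simp: image_iff intro: exI[of _ "- _"])
  have card: "card {k\<in>{a<..<b}. P (- k)} = card {k\<in>{- b<..<- a}. P k}" for a b :: int and P
    unfolding image by (rule card_image) (simp add: inj_on_def)
  fix a b v x y :: int
  show "\<chi> (- a) (- b) = \<chi> (- b) (- a)" by (rule sym)
  show "\<chi> (- (a + n)) (- b) = \<chi> (- a) (- b)"
    using periodic_simps(3)[of "- a"] by simp
  show "int (card {k\<in>{v<..<x}. \<chi> (- k) (- y) \<noteq> \<chi> (- v) (- x)}) = x - v - 1 \<or>
      m - 1 \<le> (if \<chi> (- x) (- y) \<noteq> \<chi> (- v) (- x) then 0 else y - x - 1)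
        + int (card {s\<in>{y<..<v + n}. \<chi> (- x) (- s) \<noteq> \<chi> (- v) (- x)})
        + int (card {k\<in>{v<..<x}. \<chi> (- k) (- y) \<noteq> \<chi> (- v) (- x)})"
    if "v < x" "x < y" "y < v + n"
    using balance_down[of "- v" "- y" "- x"] that
    unfolding card[of v x "\<lambda>k. \<chi> k (- y) \<noteq> \<chi> (- v) (- x)"]
      card[of y "v + n" "\<lambda>s. \<chi> (- x) s \<noteq> \<chi> (- v) (- x)"]
    by (simp split: if_split_asm)
  show "int (card {k\<in>{x<..<v}. \<chi> (- k) (- y) \<noteq> \<chi> (- v) (- x)}) = v - x - 1 \<or>
      m - 1 \<le> (if \<chi> (- x) (- y) \<noteq> \<chi> (- v) (- x) then 0 else x - y - 1)
        + int (card {s\<in>{v - n<..<y}. \<chi> (- x) (- s) \<noteq> \<chi> (- v) (- x)})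
        + int (card {k\<in>{x<..<v}. \<chi> (- k) (- y) \<noteq> \<chi> (- v) (- x)})"
    if "v - n < y" "y < x" "x < v"
    using balance_up[of "- v" "- x" "- y"] that
    unfolding card[of x v "\<lambda>k. \<chi> k (- y) \<noteq> \<chi> (- v) (- x)"]
      card[of "v - n" y "\<lambda>s. \<chi> (- x) s \<noteq> \<chi> (- v) (- x)"]
    by (simp split: if_split_asm)
qed

lemma balanced_complement: "balanced_colouring n m (\<lambda>a b. \<not> \<chi> a b)"
proof
  fix a b v x y :: int
  show "(\<not> \<chi> a b) = (\<not> \<chi> b a)" "(\<not> \<chi> (a + n) b) = (\<not> \<chi> a b)"
    using sym by auto
qed (use balance_up balance_down in simp_all)

text \<open>Otherwise all longest chords have the same colour, and a chord of the other colour of maximal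
  length would, by \<open>up_first\<close>, give a longer one.\<close>
lemma middle_change:
  assumes n_eq: "n = m + p + 1" and p_eq: "p = m - 1 + e" and e: "e = 0 \<or> e = 1" and m: "3 \<le> m"
  shows "\<exists>x. \<chi> x (x + p) \<noteq> \<chi> x (x + (p + 1)) \<or> \<chi> x (x - p) \<noteq> \<chi> x (x - (p + 1))"
proof (rule ccontr)
  assume "\<nexists>x. \<chi> x (x + p) \<noteq> \<chi> x (x + (p + 1)) \<or> \<chi> x (x - p) \<noteq> \<chi> x (x - (p + 1))"
  then have up: "\<chi> x (x + (p + 1)) = \<chi> x (x + p)" and down: "\<chi> x (x - (p + 1)) = \<chi> x (x - p)" for x
    by blast+
  \<comment> \<open>Chords of length \<open>p\<close> and \<open>p + 1\<close> at a common vertex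
    agree in both directions, so two such moves rotate a chord of length \<open>p\<close> by
    one.\<close>
  have step: "\<chi> (x + 1) (x + 1 + p) = \<chi> x (x + p)" for x
  proof -
    have "\<chi> x (x + p) = \<chi> (x + (p + 1)) x" using up sym by simp
    also have "\<dots> = \<chi> (x + (p + 1)) (x + 1)" using down[of "x + (p + 1)"] by simp
    also have "\<dots> = \<chi> (x + 1) (x + (p + 1))" by (rule sym)
    finally show ?thesis by (simp add: add_ac)
  qed
  define c where "c = \<chi> 0 p"
  have mid: "\<chi> x (x + p) = c" for x
  proof (induction x rule: int_induct[of _ 0])
    case (step2 i) then show ?case using step[of "i - 1"] by simp
  qed (use step c_def in auto)
  \<comment> \<open>Descending induction on the length; the range of \<open>t\<close> is symmetric
    because \<open>t\<close> and \<open>n - t\<close> describe the same chords.\<close>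
  have all: "\<forall>w t. p - 1 - int j < t \<and> t < n - (p - 1 - int j) \<longrightarrow> \<chi> w (w + t) = c"
    if "int j \<le> p - 2" for j
    using that
  proof (induction j)
    case 0
    show ?case
    proof (intro allI impI)
      fix w t assume "p - 1 - int 0 < t \<and> t < n - (p - 1 - int 0)"
      then consider "t = p" | "t = p + 1" | "t = n - p"
        using n_eq p_eq e by fastforce
      then show "\<chi> w (w + t) = c"
      proof cases
        case 3
        then have "w + t = n + (w - p)" by simp
        then have "\<chi> w (w + t) = \<chi> (w - p) w" using sym periodic_simps(5) by metis
        then show ?thesis using mid[of "w - p"] by simp
      qed (use mid up in auto)
    qed
  next
    case (Suc j)
    define d where "d = p - 1 - int j"
    have d: "2 \<le> d" "d \<le> p - 1" "2 * d + 1 < n" "d \<le> m - 1"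
      using Suc.prems n_eq p_eq e by (auto simp: d_def)
    have IH: "\<chi> w (w + t) = c" if "d < t" "t < n - d" for w t
      using Suc that by (auto simp: d_def)
    have new: "\<chi> w (w + d) = c" for w
    proof (rule ccontr)
      assume bad: "\<chi> w (w + d) \<noteq> c"
      have "\<chi> (w - d - 1) w = c" using IH[of "d + 1" "w - d - 1"] d by simp
      then have "min (w - (w - d - 1) - 1) (m - 1)
          \<le> int (card {k\<in>{w - d - 1<..<w}. \<chi> k (w + d) \<noteq> c})"
      proof (rule up_first[rotated 3])
        show "\<chi> w s = c" if "w + d < s" "s < w - d - 1 + n" for s
          using IH[of "s - w" w] that by simp
      qed (use bad d in auto)
      \<comment> \<open>This is the longer chord of the minority colour, of length
        \<open>d + 1\<close>.\<close>
      then have "\<chi> (w - 1) (w + d) \<noteq> c"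
        using full_card_imp_all[of w "w - d - 1" "\<lambda>k. \<chi> k (w + d) \<noteq> c" "w - 1"] d by simp
      then show False using IH[of "d + 1" "w - 1"] d by (simp add: algebra_simps)
    qed
    show ?case
    proof (intro allI impI)
      fix w t assume t: "p - 1 - int (Suc j) < t \<and> t < n - (p - 1 - int (Suc j))"
      then consider "t = d" | "t = n - d" | "d < t" "t < n - d" by (force simp: d_def)
      then show "\<chi> w (w + t) = c"
      proof cases
        case 2
        then have "w + t = n + (w - d)" by simp
        then have "\<chi> w (w + t) = \<chi> (w - d) w" using sym periodic_simps(5) by metis
        then show ?thesis using new[of "w - d"] by simp
      qed (use new IH in auto)
    qed
  qed
  have mono: "\<chi> w (w + t) = c" if "1 < t" "t < n - 1" for w t
  proof -
    have "int (nat (p - 2)) = p - 2" using p_eq e m by auto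
    then show ?thesis using all[of "nat (p - 2)"] that by simp
  qed
  \<comment> \<open>A constant colouring is not balanced: at \<open>0\<close>, \<open>2\<close>,
    \<open>3\<close> both counts vanish.\<close>
  have "{s\<in>{3<..<0 + n}. \<chi> 2 s \<noteq> c} = {}" 
  proof -
    have "\<chi> 2 s = c" if "3 < s" "s < n" for s using mono[of "s - 2" 2] that by simp
    then show ?thesis by auto
  qed
  then have "int (card {s\<in>{3<..<0 + n}. \<chi> 2 s \<noteq> c}) \<le> 0" by (simp only: card.empty)
  then have "2 - 0 - 1 \<le> int (card {k\<in>{0<..<2}. \<chi> k 3 \<noteq> c}) \<or>
    m - 1 \<le> 3 - 2 - 1 + 0 + int (card {k\<in>{0<..<2}. \<chi> k 3 \<noteq> c})"
    by (rule up_count_any[rotated -1]) (use mono[of 2 0] n_eq p_eq e m in auto)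
  moreover have "{k\<in>{0<..<2}. \<chi> k 3 \<noteq> c} = {}"
  proof -
    have "\<chi> 1 3 = c" using mono[of 2 1] n_eq p_eq e m by auto
    moreover have "{0<..<2} = {1::int}" by auto
    ultimately show ?thesis by (simp only:) auto
  qed
  then have "card {k\<in>{0<..<2}. \<chi> k 3 \<noteq> c} = 0" by (simp only: card.empty)
  ultimately show False using m by simp
qed

text \<open>Reflection fixes the direction of the change, rotation moves it to 0, and
  \<open>c\<close> makes its first chord blue.\<close>

lemma normal_position:
  assumes n_eq: "n = m + p + 1" and p_eq: "p = m - 1 + e" and e: "e = 0 \<or> e = 1" and m: "3 \<le> m"
  obtains \<sigma> t c where "\<sigma> = 1 \<or> \<sigma> = - 1"
    and "cornered_colouring n m (\<lambda>a b. \<chi> (\<sigma> * a + t) (\<sigma> * b + t) = c) p e"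
proof -
  have balanced: "balanced_colouring n m (\<lambda>a b. \<chi> (\<sigma> * a + t) (\<sigma> * b + t) = c)"
    if "\<sigma> = 1 \<or> \<sigma> = - 1" for \<sigma> t c
  proof -
    interpret shift: balanced_colouring n m "\<lambda>a b. \<chi> (a + t) (b + t)" by (rule balanced_shift)
    have "balanced_colouring n m (\<lambda>a b. \<chi> (\<sigma> * a + t) (\<sigma> * b + t))"
      using that shift.balanced_reflect balanced_shift by auto
    then show ?thesis using balanced_colouring.balanced_complement by (cases c) auto
  qed
  obtain \<sigma> t where \<sigma>: "\<sigma> = 1 \<or> \<sigma> = - 1"
    and change: "\<chi> (\<sigma> * 0 + t) (\<sigma> * p + t) \<noteq> \<chi> (\<sigma> * 0 + t) (\<sigma> * (p + 1) + t)"
  proof -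
    from middle_change[OF assms] obtain x where
      "\<chi> x (x + p) \<noteq> \<chi> x (x + (p + 1)) \<or> \<chi> x (x - p) \<noteq> \<chi> x (x - (p + 1))" by blast
    then show ?thesis using that[of 1 x] that[of "- 1" x] by (auto simp: algebra_simps)
  qed
  define c where "c = \<chi> (\<sigma> * 0 + t) (\<sigma> * p + t)"
  define \<psi> where "\<psi> = (\<lambda>a b. \<chi> (\<sigma> * a + t) (\<sigma> * b + t) = c)"
  interpret \<psi>: balanced_colouring n m \<psi> unfolding \<psi>_def by (rule balanced[OF \<sigma>])
  have corner: "\<psi> 0 p" "\<not> \<psi> 0 (p + 1)" using change by (auto simp: \<psi>_def c_def)
  show ?thesis
  proof (cases "e = 1 \<longrightarrow> \<psi> (- 1) 1")
    case True
    have "cornered_colouring n m \<psi> p e"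
      by unfold_locales (use assms corner True in auto)
    then show ?thesis using that[OF \<sigma>] unfolding \<psi>_def by blast
  next
    \<comment> \<open>For odd \<open>n\<close>, \<open>- p\<close> is congruent to
      \<open>p + 1\<close>. Reflection thus swaps the two chords of the corner, and the complement
      restores their colours; the chord from \<open>- 1\<close> to \<open>1\<close> is fixed by the
      reflection and changes colour.\<close>
    case False
    interpret \<phi>: balanced_colouring n m "\<lambda>a b. \<chi> ((- \<sigma>) * a + t) ((- \<sigma>) * b + t) = (\<not> c)"
      by (rule balanced) (use \<sigma> in auto)
    have \<phi>: "(\<chi> ((- \<sigma>) * a + t) ((- \<sigma>) * b + t) = (\<not> c)) = (\<not> \<psi> (- a) (- b))" for a b
      by (auto simp: \<psi>_def)
    have "n = 2 * p + 1" using False assms by simp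
    then have "- p = p + 1 - n" "- (p + 1) = p - n" by auto
    then have "\<psi> 0 (- p) = \<psi> 0 (p + 1)" "\<psi> 0 (- (p + 1)) = \<psi> 0 p"
      using \<psi>.periodic_simps(6) by metis+
    then have "\<not> \<psi> (- 0) (- p)" "\<psi> (- 0) (- (p + 1))"
      using corner by simp_all
    moreover have "\<not> \<psi> (- (- 1)) (- 1)" using False \<psi>.sym[of 1 "- 1"] by simp
    ultimately have "cornered_colouring n m (\<lambda>a b. \<chi> ((- \<sigma>) * a + t) ((- \<sigma>) * b + t) = (\<not> c)) p e"
      by unfold_locales (use assms \<phi> in blast)+
    then show ?thesis using that[of "- \<sigma>"] \<sigma> by auto
  qed
qed

end

section \<open>Crossing optimal drawings\<close>

lemma sum_rising: "4 * (\<Sum>q=1..a. q * (q + 1) * (q + 2)) = a * (a + 1) * (a + 2) * (a + 3)" for a :: nat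
  by (induction a) (simp_all add: algebra_simps)

lemma real_choose_three: "6 * real (n choose 3) = real n * (real n - 1) * (real n - 2)"
proof (induction n)
  case (Suc n)
  have "2 * real (n choose 2) = real n * (real n - 1)"
    by (induction n) (simp_all add: numeral_2_eq_2 algebra_simps)
  then show ?case using Suc by (simp add: numeral_3_eq_3 numeral_2_eq_2 algebra_simps)
qed simp

lemma real_choose_four: "24 * real (n choose 4) = real n * (real n - 1) * (real n - 2) * (real n - 3)"
proof (induction n)
  case (Suc n)
  have "Suc n choose 4 = (n choose 3) + (n choose 4)" by (simp add: numeral_eq_Suc)
  then show ?case using Suc real_choose_three[of n] by (simp add: algebra_simps)
qed simp

text \<open>Compared with \<open>crossings_eq_weights\<close>, this identifies \<open>Z n\<close> as
  the value at which every bound of \<open>weight_lower\<close> is attained.\<close>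

lemma Z_weights:
  assumes "6 \<le> n"
  defines "a \<equiv> n div 2 - 1" and "b \<equiv> n - 1 - n div 2"
  shows "2 * Z n + 2 * real ((n choose 2) * (a * b))
    = real (6 * (n choose 4) + (\<Sum>q=1..a. q * (q + 1) * (q + 2)) + (\<Sum>q=1..b - 1. q * (q + 1) * (q + 2)))"
proof -
  have two: "2 * real (n choose 2) = real n * (real n - 1)"
    by (induction n) (simp_all add: numeral_2_eq_2 algebra_simps)
  have rising: "4 * real (\<Sum>q=1..a. q * (q + 1) * (q + 2)) = real (a * (a + 1) * (a + 2) * (a + 3))" for a
    unfolding sum_rising[symmetric] by simp
  have "96 * Z n + 48 * (2 * real (n choose 2)) * (real a * real b)
    = 12 * (24 * real (n choose 4)) + 12 * (4 * real (\<Sum>q=1..a. q * (q + 1) * (q + 2)))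
      + 12 * (4 * real (\<Sum>q=1..b - 1. q * (q + 1) * (q + 2)))"
    unfolding two rising real_choose_four
  proof (cases "even n")
    case True
    \<comment> \<open>In terms of \<open>k\<close> all floors and truncated differences become
      polynomials.\<close>
    define k where "k = n div 2 - 3"
    have n: "n = 2 * (k + 3)" using True assms(1) by (auto elim!: evenE simp: k_def)
    then have "a = k + 2" "b = k + 2" "n div 2 = k + 3" "(n - 1) div 2 = k + 2" "(n - 2) div 2 = k + 2"
      "(n - 3) div 2 = k + 1" by (auto simp: a_def b_def)
    then show "96 * Z n + 48 * (real n * (real n - 1)) * (real a * real b)
      = 12 * (real n * (real n - 1) * (real n - 2) * (real n - 3))
        + 12 * real (a * (a + 1) * (a + 2) * (a + 3))
        + 12 * real ((b - 1) * (b - 1 + 1) * (b - 1 + 2) * (b - 1 + 3))"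
      unfolding Z_def n by (simp add: algebra_simps)
  next
    case False
    define k where "k = n div 2 - 3"
    have n: "n = 2 * (k + 3) + 1" using False assms(1) by (auto elim!: oddE simp: k_def)
    then have "a = k + 2" "b = k + 3" "n div 2 = k + 3" "(n - 1) div 2 = k + 3" "(n - 2) div 2 = k + 2"
      "(n - 3) div 2 = k + 2" by (auto simp: a_def b_def)
    then show "96 * Z n + 48 * (real n * (real n - 1)) * (real a * real b)
      = 12 * (real n * (real n - 1) * (real n - 2) * (real n - 3))
        + 12 * real (a * (a + 1) * (a + 2) * (a + 3))
        + 12 * real ((b - 1) * (b - 1 + 1) * (b - 1 + 2) * (b - 1 + 3))"
      unfolding Z_def n by (simp add: algebra_simps)
  qed
  then show ?thesis by (simp add: algebra_simps)
qed

lemma optimal_weights: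
  assumes "6 \<le> n" and opt: "real (crossings n D) = Z n" and q: "1 \<le> q" "q \<le> n div 2 - 1"
  shows "2 * weight (blue D) q n = q * (q + 1) * (q + 2)"
proof -
  define a where "a = n div 2 - 1"
  define b where "b = n - 1 - n div 2"
  let ?w = "\<lambda>q. 2 * weight (blue D) q n" and ?t = "\<lambda>q::nat. q * (q + 1) * (q + 2)"
  have le: "?t q \<le> ?w q" if "q \<in> {1..a}" for q
    using that assms(1) by (intro weight_lower) (auto simp: a_def)
  have ba: "b - 1 \<le> a" using assms(1) by (auto simp: a_def b_def)
  have "real (2 * (crossings n D + (n choose 2) * (a * b)))
      = real (6 * (n choose 4) + sum ?t {1..a} + sum ?t {1..b - 1})"
    using Z_weights[OF assms(1)] opt unfolding a_def b_def by simp
  then have "2 * (crossings n D + (n choose 2) * (a * b)) = 6 * (n choose 4) + sum ?t {1..a} + sum ?t {1..b - 1}"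
    by (simp only: of_nat_eq_iff)
  moreover have "2 * (crossings n D + (n choose 2) * (a * b)) = 6 * (n choose 4) + sum ?w {1..a} + sum ?w {1..b - 1}"
    using crossings_eq_weights[of n D] assms(1) unfolding a_def b_def by (simp flip: sum_distrib_left)
  ultimately have "sum ?w {1..a} + sum ?w {1..b - 1} = sum ?t {1..a} + sum ?t {1..b - 1}" by linarith
  moreover have "sum ?t {1..b - 1} \<le> sum ?w {1..b - 1}" "sum ?t {1..a} \<le> sum ?w {1..a}"
    using le ba by (auto intro!: sum_mono)
  ultimately have "sum ?t {1..a} = sum ?w {1..a}" by linarith
  then show ?thesis
    using sum_mono_inv[of ?t "{1..a}" ?w q] le q unfolding a_def by auto
qed

section \<open>Rotation and reflection preserve crossings\<close>

lemma f_tr_simps: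
  "\<lbrakk>1 \<le> a; a < b; b < n\<rbrakk> \<Longrightarrow> f_tr n D (a,b) = D (a + 1, b + 1)"
  "\<lbrakk>1 \<le> a; a < n\<rbrakk> \<Longrightarrow> f_tr n D (a,n) = D (1, a + 1)"
  by (auto simp: f_tr_def edges_def)

text \<open>Interleaving depends on the cyclic order only. An edge at vertex \<open>n\<close>
  becomes an edge at vertex 1, so in such a pair the two edges swap places.\<close>

lemma crossings_f_tr: "crossings n (f_tr n D) = crossings n D"
proof -
  let ?C = "\<lambda>D. {((i,j),(k,l)). (i,j) \<in> edges n \<and> (k,l) \<in> edges n \<and>
       i < k \<and> k < j \<and> j < l \<and> D (i,j) = D (k,l)}"
  let ?\<phi> = "\<lambda>((i,j),(k,l)). if l = n then ((1,k+1),(i+1,j+1)) else ((i+1,j+1),(k+1,l+1))"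
  let ?\<psi> = "\<lambda>((i,j),(k,l)). if i = 1 then ((k-1,l-1),(j-1,n)) else ((i-1,j-1),(k-1,l-1))"
  have mem: "((i,j),(k,l)) \<in> ?C D \<longleftrightarrow> 1 \<le> i \<and> i < k \<and> k < j \<and> j < l \<and> l \<le> n \<and> D (i,j) = D (k,l)"
    for i j k l D by (auto simp: edges_def)
  have "bij_betw ?\<phi> (?C (f_tr n D)) (?C D)"
  proof (rule bij_betw_byWitness[of _ ?\<psi>])
    show "\<forall>x\<in>?C (f_tr n D). ?\<psi> (?\<phi> x) = x" by (auto simp: edges_def)
    show "\<forall>x\<in>?C D. ?\<phi> (?\<psi> x) = x" by (auto simp: edges_def)
    show "?\<phi> ` ?C (f_tr n D) \<subseteq> ?C D"
    proof (rule image_subsetI)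
      fix x assume x: "x \<in> ?C (f_tr n D)"
      obtain i j k l where ijkl: "x = ((i,j),(k,l))" by (cases x) (metis surj_pair)
      have *: "1 \<le> i" "i < k" "k < j" "j < l" "l \<le> n" "f_tr n D (i,j) = f_tr n D (k,l)"
        using x unfolding ijkl mem by auto
      show "?\<phi> x \<in> ?C D"
      proof (cases "l = n")
        case True
        then have "D (1, k + 1) = D (i + 1, j + 1)"
          using * f_tr_simps(1)[of i j n D] f_tr_simps(2)[of k n D] by simp
        then have "((1,k+1),(i+1,j+1)) \<in> ?C D" unfolding mem using * by linarith
        then show ?thesis using True unfolding ijkl by simp
      next
        case False
        then have "D (i + 1, j + 1) = D (k + 1, l + 1)"
          using * f_tr_simps(1)[of i j n D] f_tr_simps(1)[of k l n D] by simp
        then have "((i+1,j+1),(k+1,l+1)) \<in> ?C D" unfolding mem using * False by linarith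
        then show ?thesis using False unfolding ijkl by simp
      qed
    qed
    show "?\<psi> ` ?C D \<subseteq> ?C (f_tr n D)"
    proof (rule image_subsetI)
      fix x assume x: "x \<in> ?C D"
      obtain i j k l where ijkl: "x = ((i,j),(k,l))" by (cases x) (metis surj_pair)
      have *: "1 \<le> i" "i < k" "k < j" "j < l" "l \<le> n" "D (i,j) = D (k,l)"
        using x unfolding ijkl mem by auto
      show "?\<psi> x \<in> ?C (f_tr n D)"
      proof (cases "i = 1")
        case True
        have "f_tr n D (k - 1, l - 1) = f_tr n D (j - 1, n)"
          using * True f_tr_simps(1)[of "k - 1" "l - 1" n D] f_tr_simps(2)[of "j - 1" n D] by simp
        then have "((k-1,l-1),(j-1,n)) \<in> ?C (f_tr n D)" unfolding mem using * by linarith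
        then show ?thesis using True unfolding ijkl by simp
      next
        case False
        have "f_tr n D (i - 1, j - 1) = f_tr n D (k - 1, l - 1)"
          using * False f_tr_simps(1)[of "i - 1" "j - 1" n D] f_tr_simps(1)[of "k - 1" "l - 1" n D] by simp
        then have "((i-1,j-1),(k-1,l-1)) \<in> ?C (f_tr n D)" unfolding mem using * False by linarith
        then show ?thesis using False unfolding ijkl by simp
      qed
    qed
  qed
  then show ?thesis unfolding crossings_def by (rule bij_betw_same_card)
qed

lemma crossings_g_tr: "crossings n (g_tr n D) = crossings n D"
proof -
  let ?C = "\<lambda>D. {((i,j),(k,l)). (i,j) \<in> edges n \<and> (k,l) \<in> edges n \<and>
       i < k \<and> k < j \<and> j < l \<and> D (i,j) = D (k,l)}"
  let ?\<phi> = "\<lambda>((i,j),(k,l)). ((n+1-l,n+1-k),(n+1-j,n+1-i))"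
  have mem: "((i,j),(k,l)) \<in> ?C D \<longleftrightarrow> 1 \<le> i \<and> i < k \<and> k < j \<and> j < l \<and> l \<le> n \<and> D (i,j) = D (k,l)"
    for i j k l D by (auto simp: edges_def)
  have closed: "?\<phi> ` ?C D \<subseteq> ?C D'"
    if D': "\<And>a b. \<lbrakk>1 \<le> a; a < b; b \<le> n\<rbrakk> \<Longrightarrow> D' (n+1-b, n+1-a) = D (a,b)" for D D' :: drawing
  proof (rule image_subsetI)
    fix x assume x: "x \<in> ?C D"
    obtain i j k l where ijkl: "x = ((i,j),(k,l))" by (cases x) (metis surj_pair)
    have *: "1 \<le> i" "i < k" "k < j" "j < l" "l \<le> n" "D (i,j) = D (k,l)"
      using x unfolding ijkl mem by auto
    have "D' (n+1-l,n+1-k) = D' (n+1-j,n+1-i)" using D'[of k l] D'[of i j] * by simp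
    then have "((n+1-l,n+1-k),(n+1-j,n+1-i)) \<in> ?C D'" unfolding mem using * by linarith
    then show "?\<phi> x \<in> ?C D'" unfolding ijkl by simp
  qed
  have "bij_betw ?\<phi> (?C (g_tr n D)) (?C D)"
  proof (rule bij_betw_byWitness[of _ ?\<phi>])
    show "?\<phi> ` ?C (g_tr n D) \<subseteq> ?C D" by (rule closed) (auto simp: g_tr_def edges_def)
    show "?\<phi> ` ?C D \<subseteq> ?C (g_tr n D)" by (rule closed) (auto simp: g_tr_def edges_def)
  qed (auto simp: edges_def)
  then show ?thesis unfolding crossings_def by (rule bij_betw_same_card)
qed

section \<open>Optimal drawings as balanced colourings\<close>

text \<open>Vertex \<open>i\<close> of the drawing is the residue class of \<open>i - 1\<close> modulo \<open>n\<close>.\<close>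
definition cyclic_blue :: "nat \<Rightarrow> drawing \<Rightarrow> int \<Rightarrow> int \<Rightarrow> bool" where
  "cyclic_blue n D a b \<longleftrightarrow> a mod int n \<noteq> b mod int n \<and>
     D (1 + nat (min (a mod int n) (b mod int n)), 1 + nat (max (a mod int n) (b mod int n))) = Blue"

lemma cyclic_blue_sym: "cyclic_blue n D a b = cyclic_blue n D b a"
  unfolding cyclic_blue_def by (auto simp: min.commute max.commute)

lemma cyclic_blue_cong:
  "a mod int n = a' mod int n \<Longrightarrow> b mod int n = b' mod int n \<Longrightarrow>
    cyclic_blue n D a b = cyclic_blue n D a' b'"
  unfolding cyclic_blue_def by simp

lemma cyclic_blue_vertices:
  assumes "1 \<le> i" "i < j" "j \<le> n"
  shows "cyclic_blue n D (int i - 1) (int j - 1) \<longleftrightarrow> D (i, j) = Blue"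
  using assms unfolding cyclic_blue_def by (simp add: nat_diff_distrib min_def max_def)


lemma cyclic_blue_f_tr:
  assumes "2 \<le> n"
  shows "cyclic_blue n (f_tr n D) a b = cyclic_blue n D (a + 1) (b + 1)"
proof -
  have main: "cyclic_blue n (f_tr n D) a b = cyclic_blue n D (a + 1) (b + 1)"
    if less: "a mod int n < b mod int n" for a b
  proof -
    define r where "r = nat (a mod int n)"
    define s where "s = nat (b mod int n)"
    have "0 < b mod int n" using less assms pos_mod_sign[of "int n" a] by linarith
    then have rs: "int r = a mod int n" "int s = b mod int n" "r < s" "s < n"
      using less assms pos_mod_bound[of "int n" b] by (auto simp: r_def s_def nat_less_iff)
    have "cyclic_blue n (f_tr n D) a b \<longleftrightarrow> f_tr n D (r + 1, s + 1) = Blue"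
      using cyclic_blue_vertices[of "r + 1" "s + 1" n "f_tr n D"] rs
        cyclic_blue_cong[of a n "int (r + 1) - 1" b "int (s + 1) - 1"] by simp
    moreover have "cyclic_blue n D (a + 1) (b + 1) = cyclic_blue n D (int r + 1) (int s + 1)"
      using rs by (intro cyclic_blue_cong) (simp_all add: mod_add_left_eq)
    moreover have "cyclic_blue n D (int r + 1) (int s + 1) \<longleftrightarrow> f_tr n D (r + 1, s + 1) = Blue"
    proof (cases "s + 1 = n")
      case True
      have "cyclic_blue n D (int r + 1) (int s + 1) = cyclic_blue n D (int 1 - 1) (int (r + 2) - 1)"
        using True by (subst cyclic_blue_sym, intro cyclic_blue_cong) (auto simp: add.commute)
      then show ?thesis
        using True rs cyclic_blue_vertices[of 1 "r + 2" n D] by (auto simp: f_tr_def edges_def)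
    next
      case False
      then show ?thesis
        using rs cyclic_blue_vertices[of "r + 2" "s + 2" n D] by (auto simp: f_tr_def edges_def add_ac)
    qed
    ultimately show ?thesis by simp
  qed
  consider "a mod int n < b mod int n" | "b mod int n < a mod int n" | "a mod int n = b mod int n"
    by linarith
  then show ?thesis
  proof cases
    case 2
    then show ?thesis using main[of b a] cyclic_blue_sym by metis
  next
    case 3
    then have "(a + 1) mod int n = (b + 1) mod int n" by (metis mod_add_left_eq)
    then show ?thesis using 3 by (simp add: cyclic_blue_def)
  qed (rule main)
qed

lemma cyclic_blue_f_tr_power:
  assumes "2 \<le> n"
  shows "cyclic_blue n ((f_tr n ^^ k) D) a b = cyclic_blue n D (a + int k) (b + int k)"
  by (induction k arbitrary: a b) (simp_all add: cyclic_blue_f_tr[OF assms] add_ac)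

lemma cyclic_blue_g_tr:
  assumes "2 \<le> n"
  shows "cyclic_blue n (g_tr n D) a b = cyclic_blue n D (- 1 - a) (- 1 - b)"
proof -
  have main: "cyclic_blue n (g_tr n D) a b = cyclic_blue n D (- 1 - a) (- 1 - b)"
    if less: "a mod int n < b mod int n" for a b
  proof -
    define r where "r = nat (a mod int n)"
    define s where "s = nat (b mod int n)"
    have "0 < b mod int n" using less assms pos_mod_sign[of "int n" a] by linarith
    then have rs: "int r = a mod int n" "int s = b mod int n" "r < s" "s < n"
      using less assms pos_mod_bound[of "int n" b] by (auto simp: r_def s_def nat_less_iff)
    have "cyclic_blue n (g_tr n D) a b \<longleftrightarrow> g_tr n D (r + 1, s + 1) = Blue"
      using cyclic_blue_vertices[of "r + 1" "s + 1" n "g_tr n D"] rs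
        cyclic_blue_cong[of a n "int (r + 1) - 1" b "int (s + 1) - 1"] by simp
    also have "\<dots> \<longleftrightarrow> cyclic_blue n D (int (n - s) - 1) (int (n - r) - 1)"
      using rs cyclic_blue_vertices[of "n - s" "n - r" n D] by (auto simp: g_tr_def edges_def)
    also have "\<dots> = cyclic_blue n D (- 1 - b) (- 1 - a)"
    proof (rule cyclic_blue_cong)
      have mod: "(int n - x mod int n - 1) mod int n = (- 1 - x) mod int n" for x
      proof -
        have "(int n - x mod int n - 1) mod int n = (- 1 - x mod int n + int n) mod int n"
          by (simp add: algebra_simps)
        also have "\<dots> = (- 1 - x) mod int n" by (simp add: mod_diff_right_eq)
        finally show ?thesis .
      qed
      show "(int (n - s) - 1) mod int n = (- 1 - b) mod int n"
        "(int (n - r) - 1) mod int n = (- 1 - a) mod int n"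
        using mod[of b] mod[of a] rs by (simp_all add: of_nat_diff)
    qed
    finally show ?thesis using cyclic_blue_sym by simp
  qed
  consider "a mod int n < b mod int n" | "b mod int n < a mod int n" | "a mod int n = b mod int n"
    by linarith
  then show ?thesis
  proof cases
    case 2
    then show ?thesis using main[of b a] cyclic_blue_sym by metis
  next
    case 3
    then have "(- 1 - a) mod int n = (- 1 - b) mod int n" by (metis mod_diff_right_eq)
    then show ?thesis using 3 by (simp add: cyclic_blue_def)
  qed (rule main)
qed

text \<open>The residue \<open>- 1\<close> is vertex \<open>n\<close>, the one removed in the
  induction, so this is \<open>above_full_or_large\<close> in cyclic notation.\<close>

lemma optimal_balance_last:
  assumes n: "6 \<le> n" and opt: "real (crossings n D) = Z n" and xy: "- 1 < x" "x < y" "y < int n - 1"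
  defines "c \<equiv> cyclic_blue n D"
  shows "int (card {k\<in>{- 1<..<x}. c k y \<noteq> c (- 1) x}) = x - - 1 - 1 \<or>
      int (n div 2) - 1 \<le> (if c x y \<noteq> c (- 1) x then 0 else y - x - 1)
        + int (card {s\<in>{y<..<- 1 + int n}. c x s \<noteq> c (- 1) x})
        + int (card {k\<in>{- 1<..<x}. c k y \<noteq> c (- 1) x})"
proof -
  obtain n' where n': "n = Suc n'" using n by (cases n) auto
  define i where "i = nat (x + 1)"
  define j where "j = nat (y + 1)"
  have ij: "1 \<le> i" "i < j" "j \<le> n'" "x = int i - 1" "y = int j - 1"
    using xy n' by (auto simp: i_def j_def)
  have c: "c (int i - 1) (int j - 1) = blue D i j" if "1 \<le> i" "i < j" "j \<le> n" for i j
    using cyclic_blue_vertices[OF that] by (simp add: c_def blue_def)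
  have c_last: "c (- 1) (int i - 1) = blue D i n" if "1 \<le> i" "i < n" for i
  proof -
    have "(- 1) mod int n = (int n - 1) mod int n"
      using mod_add_self1[of "int n" "- 1"] by simp
    then have "c (int i - 1) (- 1) = c (int i - 1) (int n - 1)"
      unfolding c_def by (intro cyclic_blue_cong) simp_all
    then have "c (- 1) (int i - 1) = c (int i - 1) (int n - 1)"
      unfolding c_def using cyclic_blue_sym by blast
    then show ?thesis using c[of i n] that by simp
  qed
  have 3: "c x y = blue D i j" "c (- 1) x = blue D i (Suc n')"
    using c[of i j] c_last[of i] ij n' by auto
  have "c k y = blue D (nat (k + 1)) j" if "- 1 < k" "k < x" for k
    using c[of "nat (k + 1)" j] that ij n' by simp
  then have "{k\<in>{- 1<..<x}. c k y \<noteq> c (- 1) x}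
      = {k\<in>{- 1<..<x}. blue D (nat (k + 1)) j \<noteq> blue D i (Suc n')}" using 3 by auto
  moreover have "card \<dots> = above (blue D) n' i j"
    unfolding above_def
    by (rule bij_betw_same_card[of "\<lambda>k. nat (k + 1)"], rule bij_betw_byWitness[of _ "\<lambda>k. int k - 1"])
      (use ij in auto)
  ultimately have 1: "card {k\<in>{- 1<..<x}. c k y \<noteq> c (- 1) x} = above (blue D) n' i j" by simp
  have "c x s = blue D i (nat (s + 1))" if "y < s" "s < int n - 1" for s
    using c[of i "nat (s + 1)"] that ij n' by simp
  then have "{s\<in>{y<..<- 1 + int n}. c x s \<noteq> c (- 1) x}
      = {s\<in>{y<..<- 1 + int n}. blue D i (nat (s + 1)) \<noteq> blue D i (Suc n')}" using 3 by auto
  moreover have "card \<dots> = card {k\<in>{j<..n'}. blue D i k \<noteq> blue D i (Suc n')}"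
    by (rule bij_betw_same_card[of "\<lambda>k. nat (k + 1)"], rule bij_betw_byWitness[of _ "\<lambda>k. int k - 1"])
      (use ij n' in auto)
  ultimately have 2: "card {s\<in>{y<..<- 1 + int n}. c x s \<noteq> c (- 1) x}
      = card {k\<in>{j<..n'}. blue D i k \<noteq> blue D i (Suc n')}" by simp
  have w: "2 * weight (blue D) q (Suc n') = q * (q + 1) * (q + 2)" if "1 \<le> q" "q \<le> n div 2 - 1" for q
    using optimal_weights[OF n opt that] unfolding n' .
  have "above (blue D) n' i j = i - 1 \<or> n div 2 - 1 \<le> along (blue D) n' i j + above (blue D) n' i j"
    by (rule above_full_or_large[OF w _ ij(1-3)]) (use n' in auto)
  moreover have "int (along (blue D) n' i j) = (if c x y \<noteq> c (- 1) x then 0 else y - x - 1)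
        + int (card {s\<in>{y<..<- 1 + int n}. c x s \<noteq> c (- 1) x})"
    unfolding along_def 2 unfolding 3 using ij by simp
  ultimately show ?thesis
    unfolding 1 using ij(1,4) n by linarith
qed

lemma crossings_f_tr_power: "crossings n ((f_tr n ^^ k) D) = crossings n D"
  by (induction k) (simp_all add: crossings_f_tr)

lemma optimal_balance_up:
  assumes n: "6 \<le> n" and opt: "real (crossings n D) = Z n" and vxy: "v < x" "x < y" "y < v + int n"
  defines "c \<equiv> cyclic_blue n D"
  shows "int (card {k\<in>{v<..<x}. c k y \<noteq> c v x}) = x - v - 1 \<or>
      int (n div 2) - 1 \<le> (if c x y \<noteq> c v x then 0 else y - x - 1)
        + int (card {s\<in>{y<..<v + int n}. c x s \<noteq> c v x})
        + int (card {k\<in>{v<..<x}. c k y \<noteq> c v x})"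
proof -
  \<comment> \<open>The rotation by \<open>t\<close> takes \<open>v\<close> to \<open>- 1\<close>;
    as \<open>f_tr\<close> turns one way only, its residue modulo \<open>n\<close> serves as the
    number of iterations.\<close>
  define t where "t = v + 1"
  define D' where "D' = (f_tr n ^^ nat (t mod int n)) D"
  have D': "cyclic_blue n D' a b = c (a + t) (b + t)" for a b
  proof -
    have "cyclic_blue n D' a b = c (a + t mod int n) (b + t mod int n)"
      unfolding D'_def c_def using n by (simp add: cyclic_blue_f_tr_power)
    also have "\<dots> = c (a + t) (b + t)"
      unfolding c_def by (rule cyclic_blue_cong) (simp_all add: mod_add_right_eq)
    finally show ?thesis .
  qed
  have "real (crossings n D') = Z n" using opt by (simp add: D'_def crossings_f_tr_power)
  moreover have "- 1 < x - t" "x - t < y - t" "y - t < int n - 1" using vxy by (auto simp: t_def)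
  ultimately have "int (card {k\<in>{- 1<..<x - t}. c (k + t) (y - t + t) \<noteq> c (- 1 + t) (x - t + t)})
      = x - t - - 1 - 1 \<or>
      int (n div 2) - 1 \<le> (if c (x - t + t) (y - t + t) \<noteq> c (- 1 + t) (x - t + t) then 0
          else y - t - (x - t) - 1)
        + int (card {s\<in>{y - t<..<- 1 + int n}. c (x - t + t) (s + t) \<noteq> c (- 1 + t) (x - t + t)})
        + int (card {k\<in>{- 1<..<x - t}. c (k + t) (y - t + t) \<noteq> c (- 1 + t) (x - t + t)})"
    unfolding D'[symmetric] by (rule optimal_balance_last[OF n])
  then show ?thesis
    unfolding card_shift[of "- 1" "x - t" "\<lambda>k. c k (y - t + t) \<noteq> c (- 1 + t) (x - t + t)" t]
      card_shift[of "y - t" "- 1 + int n" "\<lambda>s. c (x - t + t) s \<noteq> c (- 1 + t) (x - t + t)" t]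
    by (simp add: t_def add.commute split: if_split_asm)
qed

lemma optimal_balanced:
  assumes n: "6 \<le> n" and opt: "real (crossings n D) = Z n"
  shows "balanced_colouring (int n) (int (n div 2)) (cyclic_blue n D)"
proof
  let ?c = "cyclic_blue n D"
  fix a b v x y :: int
  show "?c a b = ?c b a" by (rule cyclic_blue_sym)
  show "?c (a + int n) b = ?c a b" by (rule cyclic_blue_cong) simp_all
  show "int (card {k\<in>{v<..<x}. ?c k y \<noteq> ?c v x}) = x - v - 1 \<or>
      int (n div 2) - 1 \<le> (if ?c x y \<noteq> ?c v x then 0 else y - x - 1)
        + int (card {s\<in>{y<..<v + int n}. ?c x s \<noteq> ?c v x})
        + int (card {k\<in>{v<..<x}. ?c k y \<noteq> ?c v x})"
    if "v < x" "x < y" "y < v + int n"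
    by (rule optimal_balance_up[OF n opt that])
  show "int (card {k\<in>{x<..<v}. ?c k y \<noteq> ?c v x}) = v - x - 1 \<or>
      int (n div 2) - 1 \<le> (if ?c x y \<noteq> ?c v x then 0 else x - y - 1)
        + int (card {s\<in>{v - int n<..<y}. ?c x s \<noteq> ?c v x})
        + int (card {k\<in>{x<..<v}. ?c k y \<noteq> ?c v x})"
    if "v - int n < y" "y < x" "x < v"
  proof -
    have g: "cyclic_blue n (g_tr n D) = (\<lambda>a b. ?c (- 1 - a) (- 1 - b))"
      using n by (intro ext cyclic_blue_g_tr) simp
    have "real (crossings n (g_tr n D)) = Z n" using opt by (simp add: crossings_g_tr)
    from optimal_balance_up[OF n this, of "- 1 - v" "- 1 - x" "- 1 - y"] that
    have "int (card {k\<in>{- 1 - v<..<- 1 - x}. ?c (- 1 - k) (- 1 - (- 1 - y)) \<noteq> ?c (- 1 - (- 1 - v)) (- 1 - (- 1 - x))})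
        = - 1 - x - (- 1 - v) - 1 \<or>
      int (n div 2) - 1 \<le> (if ?c (- 1 - (- 1 - x)) (- 1 - (- 1 - y)) \<noteq> ?c (- 1 - (- 1 - v)) (- 1 - (- 1 - x)) then 0
          else - 1 - y - (- 1 - x) - 1)
        + int (card {s\<in>{- 1 - y<..<- 1 - v + int n}. ?c (- 1 - (- 1 - x)) (- 1 - s) \<noteq> ?c (- 1 - (- 1 - v)) (- 1 - (- 1 - x))})
        + int (card {k\<in>{- 1 - v<..<- 1 - x}. ?c (- 1 - k) (- 1 - (- 1 - y)) \<noteq> ?c (- 1 - (- 1 - v)) (- 1 - (- 1 - x))})"
      unfolding g by linarith
    then show ?thesis
      unfolding card_reflect[of "- 1 - v" "- 1 - x" "\<lambda>k. ?c k (- 1 - (- 1 - y)) \<noteq> ?c (- 1 - (- 1 - v)) (- 1 - (- 1 - x))"]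
        card_reflect[of "- 1 - y" "- 1 - v + int n" "\<lambda>s. ?c (- 1 - (- 1 - x)) s \<noteq> ?c (- 1 - (- 1 - v)) (- 1 - (- 1 - x))"]
      by (simp add: algebra_simps split: if_split_asm)
  qed
qed

section \<open>From the colouring back to an equivalent drawing\<close>

lemma tr_steps_f_tr_power: "(tr_step n)\<^sup>*\<^sup>* D ((f_tr n ^^ k) D)"
  by (induction k) (auto simp: tr_step_def intro: rtranclp.rtrancl_into_rtrancl)

text \<open>Spine edges and \<open>1 n\<close> are excluded because \<open>h_tr\<close> keeps their
  colour.\<close>

lemma equivalent_transform:
  assumes n: "2 \<le> n" and \<sigma>: "\<sigma> = 1 \<or> \<sigma> = - 1"
  obtains D' where "equivalent n D D'"
    and "\<forall>i j. 1 \<le> i \<and> i + 1 < j \<and> j \<le> n \<and> (i,j) \<noteq> (1,n) \<longrightarrow> (D' (i,j) = Blue \<longleftrightarrow>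
      (cyclic_blue n D (\<sigma> * (int i - 1) + t) (\<sigma> * (int j - 1) + t) = c))"
proof -
  obtain E where E: "(tr_step n)\<^sup>*\<^sup>* D E"
    and cyc: "\<forall>a b. cyclic_blue n E a b = cyclic_blue n D (\<sigma> * a + t) (\<sigma> * b + t)"
    using \<sigma>
  proof
    assume \<sigma>: "\<sigma> = 1"
    show ?thesis
    proof (rule that[OF tr_steps_f_tr_power], intro allI)
      show "cyclic_blue n ((f_tr n ^^ nat (t mod int n)) D) a b = cyclic_blue n D (\<sigma> * a + t) (\<sigma> * b + t)"
        for a b
        unfolding cyclic_blue_f_tr_power[OF n] \<sigma>
        by (rule cyclic_blue_cong) (use n in \<open>simp_all add: mod_add_right_eq\<close>)
    qed
  next
    assume \<sigma>: "\<sigma> = - 1"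
    have "(tr_step n)\<^sup>*\<^sup>* D (g_tr n D)" by (auto simp: tr_step_def)
    then have steps: "(tr_step n)\<^sup>*\<^sup>* D ((f_tr n ^^ k) (g_tr n D))" for k
      using tr_steps_f_tr_power rtranclp_trans by metis
    show ?thesis
    proof (rule that[OF steps], intro allI)
      \<comment> \<open>The number of rotations solves \<open>- 1 - (a + k) = - a + t\<close> modulo
        \<open>n\<close>.\<close>
      show "cyclic_blue n ((f_tr n ^^ nat ((- 1 - t) mod int n)) (g_tr n D)) a b
          = cyclic_blue n D (\<sigma> * a + t) (\<sigma> * b + t)" for a b
        unfolding cyclic_blue_f_tr_power[OF n] cyclic_blue_g_tr[OF n] \<sigma>
      proof (rule cyclic_blue_cong)
        have *: "(- 1 - (x + int (nat ((- 1 - t) mod int n)))) mod int n = (- 1 * x + t) mod int n" for x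
        proof -
          have "(- 1 - (x + int (nat ((- 1 - t) mod int n)))) mod int n
              = (- 1 - x - (- 1 - t) mod int n) mod int n" using n by (simp add: algebra_simps)
          also have "\<dots> = (- 1 - x - (- 1 - t)) mod int n" by (rule mod_diff_right_eq)
          finally show ?thesis by simp
        qed
        show "(- 1 - (a + int (nat ((- 1 - t) mod int n)))) mod int n = (- 1 * a + t) mod int n"
          "(- 1 - (b + int (nat ((- 1 - t) mod int n)))) mod int n = (- 1 * b + t) mod int n"
          by (rule *)+
      qed
    qed
  qed
  define D' where "D' = (if c then E else h_tr n E)"
  have "(tr_step n)\<^sup>*\<^sup>* D D'"
    using E unfolding D'_def by (auto simp: tr_step_def intro: rtranclp.rtrancl_into_rtrancl)
  then have "equivalent n D D'" by (simp add: equivalent_def)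
  moreover have "D' (i,j) = Blue \<longleftrightarrow>
      (cyclic_blue n D (\<sigma> * (int i - 1) + t) (\<sigma> * (int j - 1) + t) = c)"
    if ij: "1 \<le> i" "i + 1 < j" "j \<le> n" "(i,j) \<noteq> (1,n)" for i j
  proof -
    have "h_tr n E (i,j) = flip (E (i,j))" using ij by (auto simp: h_tr_def edges_def)
    then have "D' (i,j) = Blue \<longleftrightarrow> ((E (i,j) = Blue) = c)"
      unfolding D'_def by (cases "E (i,j)") auto
    then show ?thesis using cyclic_blue_vertices[of i j n E] ij cyc by simp
  qed
  ultimately show ?thesis using that[of D'] by blast
qed

theorem theorem19:
  fixes n :: nat and D :: drawing
  assumes "n \<ge> 6"
    and "crossing_optimal n D"
  defines "e \<equiv> (if even n then 0 else 1 :: nat)"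
  shows "\<exists>D'. equivalent n D D' \<and>
    (\<forall>s r. ((4 + e \<le> s \<and> s \<le> n div 2 + 1) \<or> (n + 2 + e \<le> s \<and> s \<le> n + n div 2 + 1))
        \<and> max 1 (s - n) \<le> r \<and> 2 * r + 5 \<le> s \<longrightarrow> D' (r, s - r) = Blue) \<and>
    (\<forall>s r. (((n+1) div 2 + 2 + e \<le> s \<and> s \<le> n) \<or>
            (n + (n+1) div 2 + 2 + e \<le> s \<and> s \<le> 2 * n - 2 - e))
        \<and> max 1 (s - n) \<le> r \<and> 2 * r + 5 \<le> s \<and> (r, s - r) \<noteq> (1, n)
        \<longrightarrow> D' (r, s - r) = Red) \<and>
    (odd n \<longrightarrow> D' (1, (n+1) div 2 + 1) = Red \<and> D' (n div 2, (n+1) div 2 + 1) = Red \<and>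
               D' (2, n) = Blue \<and> D' ((n+1) div 2, (n+1) div 2 + 2) = Blue)"
proof -
  define m where "m = n div 2"
  define p where "p = n - m - 1"
  have e_cases: "e = 0 \<or> e = 1" by (simp add: e_def)
  have n_eq: "n = 2 * m + e" by (auto simp: e_def m_def)
  have ceil: "(n + 1) div 2 = m + e" using n_eq e_cases by auto
  have m: "3 \<le> m" using assms(1) by (simp add: m_def)
  have p_eq: "p = m + e - 1" "n = m + p + 1" using n_eq m by (auto simp: p_def)
  have opt: "real (crossings n D) = Z n" using assms(2) by (simp add: crossing_optimal_def)
  interpret balanced_colouring "int n" "int m" "cyclic_blue n D"
    unfolding m_def by (rule optimal_balanced[OF assms(1) opt])
  obtain \<sigma> t c where \<sigma>: "\<sigma> = 1 \<or> \<sigma> = - 1"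
    and cornered: "cornered_colouring (int n) (int m)
      (\<lambda>a b. cyclic_blue n D (\<sigma> * a + t) (\<sigma> * b + t) = c) (int p) (int e)"
    by (rule normal_position[of "int p" "int e"]) (use p_eq m e_cases in auto)
  define \<chi> where "\<chi> = (\<lambda>a b. cyclic_blue n D (\<sigma> * a + t) (\<sigma> * b + t) = c)"
  interpret \<chi>: cornered_colouring "int n" "int m" \<chi> "int p" "int e"
    unfolding \<chi>_def by (rule cornered)
  obtain D' where D': "equivalent n D D'"
    and all: "\<forall>i j. 1 \<le> i \<and> i + 1 < j \<and> j \<le> n \<and> (i,j) \<noteq> (1,n) \<longrightarrow> (D' (i,j) = Blue \<longleftrightarrow>
      (cyclic_blue n D (\<sigma> * (int i - 1) + t) (\<sigma> * (int j - 1) + t) = c))"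
    by (rule equivalent_transform[OF _ \<sigma>, of n]) (use assms(1) in auto)
  have colour: "D' (i,j) = Blue \<longleftrightarrow> \<chi> (int i - 1) (int j - 1)"
    if "1 \<le> i" "i + 1 < j" "j \<le> n" "(i,j) \<noteq> (1,n)" for i j
    unfolding \<chi>_def using all that by blast
  have red: "D' (i,j) = Red \<longleftrightarrow> \<not> \<chi> (int i - 1) (int j - 1)"
    if "1 \<le> i" "i + 1 < j" "j \<le> n" "(i,j) \<noteq> (1,n)" for i j
    using colour[OF that] by (cases "D' (i,j)") auto
  have blue_entry: "D' (r, s - r) = Blue"
    if s: "(4 + e \<le> s \<and> s \<le> m + 1) \<or> (n + 2 + e \<le> s \<and> s \<le> n + m + 1)"
      and r: "1 \<le> r" "s \<le> n + r" "2 * r + 5 \<le> s" for s r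
  proof -
    \<comment> \<open>Vertices are shifted to residues, so the antidiagonal \<open>s\<close> becomes
      \<open>k + j = s - 2\<close>.\<close>
    define k where "k = int r - 1"
    define j where "j = int (s - r) - 1"
    have kj: "0 \<le> k" "k + 5 \<le> j" "j \<le> int n - 1" "k + j = int s - 2"
      using r by (auto simp: k_def j_def)
    have "\<chi> k j"
    proof (cases "s \<le> m + 1")
      case True
      then have small: "k + j \<le> int m - 1" using kj by simp
      show ?thesis
      proof (cases "k = 0")
        case True
        then show ?thesis using \<chi>.row0_blue[of j] small kj p_eq m e_cases by auto
      next
        case False
        then show ?thesis using \<chi>.left_blue[of k j] small kj e_cases by auto
      qed
    next
      case False
      then have big: "int n + int e \<le> k + j" "k + j \<le> int n + int m - 1" using kj s by auto
      show ?thesis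
      proof (cases "k \<le> int p")
        case True
        then show ?thesis using \<chi>.rectangle_blue[of k j] big kj p_eq e_cases by auto
      next
        case False
        then show ?thesis using \<chi>.right_blue[of k j] big kj e_cases by auto
      qed
    qed
    moreover have "1 \<le> r" "r + 1 < s - r" "s - r \<le> n" "(r, s - r) \<noteq> (1, n)"
      using s r n_eq by auto
    note colour[OF this]
    ultimately show ?thesis unfolding k_def j_def by (simp only: not_False_eq_True)
  qed
  have red_entry: "D' (r, s - r) = Red"
    if s: "(m + e + 2 + e \<le> s \<and> s \<le> n) \<or> (n + (m + e) + 2 + e \<le> s)"
      and r: "1 \<le> r" "s \<le> n + r" "2 * r + 5 \<le> s" "(r, s - r) \<noteq> (1, n)" for s r
  proof -
    define k where "k = int r - 1"
    define j where "j = int (s - r) - 1"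
    have kj: "0 \<le> k" "k + 5 \<le> j" "j \<le> int n - 1" "k + j = int s - 2"
      using r by (auto simp: k_def j_def)
    have "\<not> \<chi> k j"
    proof (cases "s \<le> n")
      case True
      then have small: "int p + 1 + int e \<le> k + j" "k + j \<le> int n - 2" using kj s p_eq m by auto
      show ?thesis
      proof (cases "k = 0")
        case True
        then show ?thesis using \<chi>.row0_red[of j] small kj by auto
      next
        case k: False
        show ?thesis
        proof (cases "j \<le> int p")
          case True
          then show ?thesis using \<chi>.left_red[of k j] small kj k by auto
        next
          case False
          then show ?thesis using \<chi>.rectangle_red[of k j] small kj k p_eq e_cases by auto
        qed
      qed
    next
      case False
      then have big: "int n + int p + 1 + int e \<le> k + j" using kj s p_eq m by auto
      then show ?thesis using \<chi>.right_red[of k j] kj by auto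
    qed
    moreover have "1 \<le> r" "r + 1 < s - r" "s - r \<le> n" using r by linarith+
    note red[OF this r(4)]
    ultimately show ?thesis unfolding k_def j_def by (simp only: not_False_eq_True)
  qed
  \<comment> \<open>As residues these are \<open>0, p + 1\<close> from the corner,
    \<open>p - 1, p + 1\<close> and \<open>p, p + 2\<close> from the two fans, and
    \<open>1, n - 1\<close> from the tip.\<close>
  have odd_entries: "D' (1, (n+1) div 2 + 1) = Red \<and> D' (n div 2, (n+1) div 2 + 1) = Red \<and>
      D' (2, n) = Blue \<and> D' ((n+1) div 2, (n+1) div 2 + 2) = Blue" if "odd n"
  proof -
    have e1: "e = 1" using that by (simp add: e_def)
    have e: "e = 1" "p = m" "n = 2 * m + 1"
      using e1 p_eq(1) n_eq by simp_all
    have "\<chi> (- 1) 1" using \<chi>.tip e by simp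
    then have "\<chi> (int n - 1) 1"
      using \<chi>.periodic_simps(2)[of "- 1" 1] by simp
    then have "\<chi> 1 (int n - 1)" using \<chi>.sym by blast
    then have "D' (2, n) = Blue" using colour[of 2 n] e m by simp
    moreover have "\<not> \<chi> 0 (int m + 1)" using \<chi>.corner e by simp
    then have "D' (1, m + 2) = Red" using red[of 1 "m + 2"] e m by (simp add: add.commute)
    moreover have "\<not> \<chi> (int m - 1) (int m + 1)"
      using \<chi>.fan_Suc_p[of "int p - 1"] e m by simp
    then have "D' (m, m + 2) = Red" using red[of m "m + 2"] e m by (simp add: add.commute)
    moreover have "\<chi> (int m) (int m + 2)"
      using \<chi>.fan_p[of "int p + 2"] e m \<chi>.sym[of "int m" "int m + 2"] by simp
    then have "D' (m + 1, m + 3) = Blue" using colour[of "m + 1" "m + 3"] e m by (simp add: add.commute)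
    ultimately show ?thesis unfolding ceil m_def[symmetric] e1 by (simp add: numeral_eq_Suc)
  qed
  show ?thesis
  proof (intro exI[of _ D'] conjI allI impI)
    show "equivalent n D D'" by (rule D')
  next
    fix s r
    assume "((4 + e \<le> s \<and> s \<le> n div 2 + 1) \<or> (n + 2 + e \<le> s \<and> s \<le> n + n div 2 + 1))
        \<and> max 1 (s - n) \<le> r \<and> 2 * r + 5 \<le> s"
    then show "D' (r, s - r) = Blue"
      unfolding m_def[symmetric] by (intro blue_entry) auto
  next
    fix s r
    assume "(((n+1) div 2 + 2 + e \<le> s \<and> s \<le> n) \<or>
            (n + (n+1) div 2 + 2 + e \<le> s \<and> s \<le> 2 * n - 2 - e))
        \<and> max 1 (s - n) \<le> r \<and> 2 * r + 5 \<le> s \<and> (r, s - r) \<noteq> (1, n)"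
    then show "D' (r, s - r) = Red"
      unfolding ceil by (intro red_entry) auto
  qed (use odd_entries in blast)+
qed

end
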